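(* Let $N=\{1,2,\ldots,n\}$ and let $N=N_1\cup N_2\cup\cdots\cup N_m$ be a partition of $N$ into disjoint nonempty subsets. Let $f:\mathbb{Z}^N\to\mathbb{R}\cup\{+\infty\}$ be a jump M$^\natural$-convex function, and let $g:\mathbb{Z}^m\to\mathbb{R}\cup\{+\infty,-\infty\}$ be its aggregation, $$g(y_1,y_2,\ldots,y_m)=\inf\{f(x)\mid x\in\mathbb{Z}^N,\ x(N_j)=y_j\ (j=1,2,\ldots,m)\}.$$ If $g$ does not take the value $-\infty$, then $g$ is jump M$^\natural$-convex.
   Context: For $x\in\mathbb{Z}^N$ and $U\subseteq N$, $x(U)=\sum_{i\in U}x_i$. For a finite index set $N$ and a function $f:\mathbb{Z}^N\to\mathbb{R}\cup\{+\infty\}$, the effective domain is $\operatorname{dom} f=\{x\in\mathbb{Z}^N\mid f(x)<+\infty\}$; it is always assumed to be nonempty. $\mathbf{1}^i$ denotes the $i$th unit vector. For integer vectors $x,y$, let $x\vee y$ and $x\wedge y$ be the componentwise maximum and minimum, and $[x\wedge y,x\vee y]_{\mathbb{Z}}$ the set of integer vectors $z$ with $x\wedge y\le z\le x\vee y$ componentwise. A vector $s\in\mathbb{Z}^N$ is an $(x,y)$-increment if $s=\mathbf{1}^i$ or $s=-\mathbf{1}^i$ for some $i\in N$ and $x+s\in[x\wedge y,x\vee y]_{\mathbb{Z}}$. A function $f$ is jump M$^\natural$-convex if it satisfies (JM$^\natural$-EXC): for any $x,y\in\operatorname{dom} f$ and any $(x,y)$-increment $s$, (i) or (ii) holds: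 (i) $x+s\in\operatorname{dom} f$, $y-s\in\operatorname{dom} f$, and $f(x)+f(y)\ge f(x+s)+f(y-s)$; (ii) there exists an $(x+s,y)$-increment $t$ such that $x+s+t\in\operatorname{dom} f$, $y-s-t\in\operatorname{dom} f$, and $f(x)+f(y)\ge f(x+s+t)+f(y-s-t)$. The infimum over the empty set is $+\infty$. *)

theory Defs
  imports Complex_Main "HOL-Library.Extended_Real" "HOL-Library.Function_Algebras"
    "HOL-Library.Disjoint_Sets"
begin

text \<open>
  Integer vectors indexed by \<open>N\<close> are represented as functions on the whole index type that vanish
  outside \<open>N\<close>. Sums and differences of vectors are the pointwise operations, and the order
  and lattice operations on functions are the componentwise ones, so that
  \<open>{inf x y..sup x y}\<close> is the integer box spanned by \<open>x\<close> and \<open>y\<close>; it stays inside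
  \<open>int_vecs N\<close> whenever \<open>x\<close> and \<open>y\<close> belong to it.
\<close>

definition int_vecs :: "'a set \<Rightarrow> ('a \<Rightarrow> int) set" where
  "int_vecs N = {x. \<forall>i. i \<notin> N \<longrightarrow> x i = 0}"

definition unit_vec :: "'a \<Rightarrow> 'a \<Rightarrow> int" where
  "unit_vec i = (\<lambda>k. if k = i then 1 else 0)"

definition increment :: "'a set \<Rightarrow> ('a \<Rightarrow> int) \<Rightarrow> ('a \<Rightarrow> int) \<Rightarrow> ('a \<Rightarrow> int) \<Rightarrow> bool" where
  "increment N x y s \<longleftrightarrow>
     (\<exists>i\<in>N. s = unit_vec i \<or> s = - unit_vec i) \<and> x + s \<in> {inf x y..sup x y}"

text \<open>Only the values of \<open>f\<close> on \<open>int_vecs N\<close> are relevant in the following notions.\<close>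

definition eff_dom :: "'a set \<Rightarrow> (('a \<Rightarrow> int) \<Rightarrow> ereal) \<Rightarrow> ('a \<Rightarrow> int) set" where
  "eff_dom N f = {x \<in> int_vecs N. f x < \<infinity>}"

definition JM_nat_EXC :: "'a set \<Rightarrow> (('a \<Rightarrow> int) \<Rightarrow> ereal) \<Rightarrow> bool" where
  "JM_nat_EXC N f \<longleftrightarrow>
     (\<forall>x\<in>eff_dom N f. \<forall>y\<in>eff_dom N f. \<forall>s. increment N x y s \<longrightarrow>
        (x + s \<in> eff_dom N f \<and> y - s \<in> eff_dom N f \<and> f x + f y \<ge> f (x + s) + f (y - s)) \<or>
        (\<exists>t. increment N (x + s) y t \<and>
             x + s + t \<in> eff_dom N f \<and> y - s - t \<in> eff_dom N f \<and>
             f x + f y \<ge> f (x + s + t) + f (y - s - t)))"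

text \<open>
  The first two conjuncts are the standing assumptions: \<open>f\<close> takes values in the reals extended by
  \<open>\<infinity>\<close> only, and its effective domain is nonempty.
\<close>

definition jump_M_nat_convex :: "'a set \<Rightarrow> (('a \<Rightarrow> int) \<Rightarrow> ereal) \<Rightarrow> bool" where
  "jump_M_nat_convex N f \<longleftrightarrow>
     (\<forall>x\<in>int_vecs N. f x \<noteq> -\<infinity>) \<and> eff_dom N f \<noteq> {} \<and> JM_nat_EXC N f"

definition aggregation ::
  "'a set \<Rightarrow> 'b set \<Rightarrow> ('b \<Rightarrow> 'a set) \<Rightarrow> (('a \<Rightarrow> int) \<Rightarrow> ereal) \<Rightarrow> ('b \<Rightarrow> int) \<Rightarrow> ereal" where
  "aggregation N J B f y = (INF x\<in>{x \<in> int_vecs N. \<forall>j\<in>J. (\<Sum>i\<in>B j. x i) = y j}. f x)"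

end

theory Submission imports Defs begin

text \<open>
  The proof works with exchange properties of functions that have a finite domain and real values, and in which the
  infima are minima. This is no restriction: the exchange inequality for the aggregation at a pair
  \<open>y\<close>, \<open>y'\<close> follows from inequalities for all pairs \<open>x\<close>, \<open>x'\<close> in the two fibres, and for each of them \<open>f\<close> can be restricted
  to the integer box spanned by \<open>x\<close> and \<open>x'\<close> (\<open>aggregation_jump_M_nat_convex\<close>).

  A jump M\<open>\<natural>\<close>-convex function becomes jump M-convex, that is, each first step is completed by exactly one second step,
  when the parity of the coordinate sum is recorded as an additional coordinate (\<open>jump_M_lift\<close>). Aggregation commutes with
  this lift, and it is a sequence of elementary aggregations each of which merges two coordinates
  (\<open>jump_M_agg\<close>). It remains to show that merging preserves jump M-convexity (\<open>jump_M_merge\<close>).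

  Both the lift and the merging rest on the same two tools. The first is a local-to-global principle
  (\<open>local_to_global\<close>): if the domain satisfies the one-sided two-step axiom, the exchange property has to be
  verified only for vectors at distance 4, where it says that
  \<open>f x + f y\<close> is at least the value sum of one of the pairs of opposite midpoints. The second is a criterion for this
  local property (\<open>pivot_midpoint\<close>). Suppose it fails for \<open>x\<close> and \<open>y\<close>. After adding
  suitable weights to the four unit steps that lead from \<open>x\<close> to \<open>y\<close>, one has \<open>f x = f y\<close>, and every midpoint has a
  larger value. Let \<open>q\<close> be a unit step in a direction \<open>a\<close> in which \<open>x\<close> and \<open>y\<close> agree, and consider the layer formed by the
  vectors one step away from \<open>x + q\<close> or \<open>y + q\<close>, towards the other one. If exchange with first steps in
  direction \<open>a\<close> is available, such a vector and the end farther from it can be exchanged for a midpoint and another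
  vector of the layer. Since the midpoint has a larger value than the end, the value on the
  layer strictly decreases, which cannot go on forever; so the layer is empty.
  For the lift, \<open>a\<close> is the parity coordinate; for merging, it is the merged coordinate, and
  exchange with first steps in direction \<open>a\<close> comes from a walk in the plane of the two coordinates that are merged
  (\<open>merged_coordinate_exch\<close>).
\<close>

section \<open>Boxes, unit steps and distance\<close>

text \<open>
  The vector \<open>z\<close> lies in the integer box spanned by \<open>x\<close> and \<open>y\<close>. Writing this coordinatewise as a
  disjunction treats increasing and decreasing coordinates alike.
\<close>

definition between :: "('a \<Rightarrow> int) \<Rightarrow> ('a \<Rightarrow> int) \<Rightarrow> ('a \<Rightarrow> int) \<Rightarrow> bool" where
  "between x z y \<longleftrightarrow> (\<forall>i. x i \<le> z i \<and> z i \<le> y i \<or> y i \<le> z i \<and> z i \<le> x i)"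

text \<open>
  One unit step: \<open>u - x\<close> is a signed unit vector. An increment \<open>s\<close> from \<open>x\<close> towards \<open>y\<close> thus becomes
  its endpoint \<open>u = x + s\<close>, which is adjacent to \<open>x\<close> and lies between \<open>x\<close> and \<open>y\<close>.
\<close>

definition adjacent :: "('a \<Rightarrow> int) \<Rightarrow> ('a \<Rightarrow> int) \<Rightarrow> bool" where
  "adjacent x u \<longleftrightarrow> (\<exists>i. \<bar>u i - x i\<bar> = 1 \<and> (\<forall>k. k \<noteq> i \<longrightarrow> u k = x k))"

text \<open>
  The \<open>l1\<close> distance over the finite coordinate set \<open>N\<close>, as a natural number so that it can serve as an
  induction measure.
\<close>

definition l1 :: "'a set \<Rightarrow> ('a \<Rightarrow> int) \<Rightarrow> ('a \<Rightarrow> int) \<Rightarrow> nat" where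
  "l1 N x y = (\<Sum>i\<in>N. nat \<bar>x i - y i\<bar>)"

lemma between_sym: "between x z y \<longleftrightarrow> between y z x"
  unfolding between_def by blast

lemma between_refl [simp]: "between x x y" "between x y y"
  unfolding between_def by (auto simp: linear)

lemma between_trans:
  assumes "between x u y" "between u w y"
  shows "between x w y" "between x u w"
proof -
  have *: "(x i \<le> w i \<and> w i \<le> y i \<or> y i \<le> w i \<and> w i \<le> x i) \<and>
      (x i \<le> u i \<and> u i \<le> w i \<or> w i \<le> u i \<and> u i \<le> x i)" for i
    using assms[unfolded between_def, rule_format, of i] by linarith
  then show "between x w y" "between x u w"
    unfolding between_def by blast+
qed

lemma between_trans':
  assumes "between x u y" "between x w u"
  shows "between x w y" "between w u y"
proof -
  have "between y u x" "between u w x"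
    using assms between_sym by blast+
  from between_trans[OF this] show "between x w y" "between w u y"
    using between_sym by blast+
qed

lemma between_compl: "between x w y \<Longrightarrow> between x (x + y - w) y"
  unfolding between_def by (auto simp: plus_fun_def fun_diff_def)

lemma int_vecs_between:
  assumes "between x z y" "x \<in> int_vecs N" "y \<in> int_vecs N"
  shows "z \<in> int_vecs N"
proof -
  have "z i = 0" if "i \<notin> N" for i
    using assms(1)[unfolded between_def, rule_format, of i] assms(2,3) that
    by (auto simp: int_vecs_def)
  then show ?thesis by (simp add: int_vecs_def)
qed

lemma adjacent_sym: "adjacent x u \<longleftrightarrow> adjacent u x"
  unfolding adjacent_def by (metis abs_minus_commute)

lemma adjacentE:
  assumes "adjacent x u"
  obtains i where "\<bar>u i - x i\<bar> = 1" "\<And>k. k \<noteq> i \<Longrightarrow> u k = x k"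
  using assms unfolding adjacent_def by blast

lemma l1_sym: "l1 N x y = l1 N y x"
  unfolding l1_def by (simp add: abs_minus_commute)

lemma l1_self [simp]: "l1 N x x = 0"
  by (simp add: l1_def)

lemma l1_between:
  assumes "between x z y"
  shows "l1 N x z + l1 N z y = l1 N x y"
proof -
  have "\<bar>x i - z i\<bar> + \<bar>z i - y i\<bar> = \<bar>x i - y i\<bar>" for i
    using assms[unfolded between_def, rule_format, of i] by auto
  then have "nat \<bar>x i - z i\<bar> + nat \<bar>z i - y i\<bar> = nat \<bar>x i - y i\<bar>" for i
    by (metis abs_ge_zero nat_add_distrib)
  then show ?thesis
    unfolding l1_def sum.distrib[symmetric] by simp
qed

lemma l1_compl: "l1 N (x + y - w) y = l1 N x w" "l1 N x (x + y - w) = l1 N w y"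
  unfolding l1_def by (auto intro!: sum.cong)

lemma l1_0:
  assumes "finite N" "l1 N x y = 0" "x \<in> int_vecs N" "y \<in> int_vecs N"
  shows "x = y"
proof
  fix i show "x i = y i"
    using assms by (cases "i \<in> N") (auto simp: l1_def int_vecs_def)
qed

lemma l1_adjacent:
  assumes "finite N" "x \<in> int_vecs N" "u \<in> int_vecs N"
  shows "adjacent x u \<longleftrightarrow> l1 N x u = 1"
proof
  assume "adjacent x u"
  then obtain i where i: "\<bar>u i - x i\<bar> = 1" "\<And>k. k \<noteq> i \<Longrightarrow> u k = x k"
    by (rule adjacentE) blast
  have "i \<in> N"
    using assms(2,3) i(1) by (intro ccontr[of "i \<in> N"]) (auto simp: int_vecs_def)
  have "l1 N x u = nat \<bar>x i - u i\<bar> + (\<Sum>k\<in>N - {i}. nat \<bar>x k - u k\<bar>)"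
    unfolding l1_def using assms(1) \<open>i \<in> N\<close> by (rule sum.remove)
  also have "\<dots> = 1"
    using i by (simp add: abs_minus_commute)
  finally show "l1 N x u = 1" .
next
  assume "l1 N x u = 1"
  then obtain i where i: "i \<in> N" "nat \<bar>x i - u i\<bar> = Suc 0"
    "\<And>k. k \<in> N \<Longrightarrow> i \<noteq> k \<Longrightarrow> nat \<bar>x k - u k\<bar> = 0"
    using assms(1) unfolding l1_def by (auto simp: sum_eq_Suc0_iff)
  have "\<bar>u i - x i\<bar> = 1" using i(2) by linarith
  moreover have "u k = x k" if "k \<noteq> i" for k
    using i(3)[of k] that assms(2,3) by (cases "k \<in> N") (auto simp: int_vecs_def)
  ultimately show "adjacent x u"
    unfolding adjacent_def by blast
qed

lemma adjacent_exists:
  assumes "x \<noteq> y"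
  obtains u where "adjacent x u" "between x u y"
proof -
  obtain i where i: "x i \<noteq> y i" using assms by auto
  let ?u = "x(i := x i + sgn (y i - x i))"
  have "adjacent x ?u"
    unfolding adjacent_def using i by (intro exI[of _ i]) (auto simp: sgn_if)
  moreover have "between x ?u y"
    unfolding between_def using i by (auto simp: sgn_if)
  ultimately show ?thesis by (rule that)
qed

text \<open>
  A step in coordinate \<open>j\<close> towards \<open>y\<close> is also a step towards every \<open>z\<close> of the box that has moved in
  coordinate \<open>j\<close>; this is how it is verified below that a vector has kept a prescribed first step.
\<close>

lemma between_step:
  assumes "between x u y" "between x z y" "\<bar>u j - x j\<bar> = 1" "\<And>k. k \<noteq> j \<Longrightarrow> u k = x k" "z j \<noteq> x j"
  shows "between u z y" "between x u z"
proof -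
  have *: "(u i \<le> z i \<and> z i \<le> y i \<or> y i \<le> z i \<and> z i \<le> u i) \<and>
      (x i \<le> u i \<and> u i \<le> z i \<or> z i \<le> u i \<and> u i \<le> x i)" for i
  proof (cases "i = j")
    case True
    show ?thesis
      unfolding True
      using assms(1,2)[unfolded between_def, rule_format, of j] assms(3,5) by linarith
  next
    case False
    then show ?thesis
      using assms(2)[unfolded between_def, rule_format, of i] assms(4)[of i] by auto
  qed
  then show "between u z y" "between x u z"
    unfolding between_def by blast+
qed

section \<open>Exchange properties\<close>

text \<open>
  Replacing the pair \<open>(x, y)\<close> by the pair \<open>(w, x + y - w)\<close> of the same sum stays in \<open>D\<close> and does not
  increase the sum of the two values. A function is given here by its effective domain \<open>D\<close> and real values; those
  outside \<open>D\<close> are irrelevant.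
\<close>

definition exch ::
  "('a \<Rightarrow> int) set \<Rightarrow> (('a \<Rightarrow> int) \<Rightarrow> real) \<Rightarrow> ('a \<Rightarrow> int) \<Rightarrow> ('a \<Rightarrow> int) \<Rightarrow> ('a \<Rightarrow> int) \<Rightarrow> bool" where
  "exch D f x y w \<longleftrightarrow> w \<in> D \<and> x + y - w \<in> D \<and> f w + f (x + y - w) \<le> f x + f y"

text \<open>
  The exchange property of jump M-convex functions: every first step \<open>u\<close> can be completed by exactly
  one further step. In contrast to the natural version, stopping at \<open>u\<close> is not permitted, which
  forces vectors of \<open>D\<close> that differ in finitely many coordinates to have an even distance.
\<close>

definition jump_M :: "('a \<Rightarrow> int) set \<Rightarrow> (('a \<Rightarrow> int) \<Rightarrow> real) \<Rightarrow> bool" where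
  "jump_M D f \<longleftrightarrow> (\<forall>x\<in>D. \<forall>y\<in>D. \<forall>u. adjacent x u \<and> between x u y \<longrightarrow>
     (\<exists>w. adjacent u w \<and> between u w y \<and> exch D f x y w))"

text \<open>
  The two-step axiom of a constant-parity jump system: only \<open>x\<close> moves, and \<open>y\<close> stays.
\<close>

definition one_sided :: "('a \<Rightarrow> int) set \<Rightarrow> bool" where
  "one_sided D \<longleftrightarrow> (\<forall>x\<in>D. \<forall>y\<in>D. \<forall>u. adjacent x u \<and> between x u y \<longrightarrow>
     (\<exists>w\<in>D. adjacent u w \<and> between u w y))"

text \<open>
  The local exchange property: for a pair at distance 4, the value sum of the pair is at least that of
  one of the (at most three) pairs of opposite vectors halfway between them.
\<close>

definition midpoint :: "'a set \<Rightarrow> ('a \<Rightarrow> int) set \<Rightarrow> (('a \<Rightarrow> int) \<Rightarrow> real) \<Rightarrow> bool" where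
  "midpoint N D f \<longleftrightarrow> (\<forall>x\<in>D. \<forall>y\<in>D. l1 N x y = 4 \<longrightarrow>
     (\<exists>w. l1 N x w = 2 \<and> between x w y \<and> exch D f x y w))"

lemma exch_compl: "exch D f x y w \<longleftrightarrow> exch D f x y (x + y - w)"
  unfolding exch_def by (auto simp: add.commute)

lemma exch_sym: "exch D f x y w \<longleftrightarrow> exch D f y x w"
  unfolding exch_def by (auto simp: add.commute)

section \<open>From local to global exchange\<close>

text \<open>
  A linear functional. Adding one to \<open>f\<close> does not affect exchange inequalities, because
  the two pairs compared there have the same sum.
\<close>

definition lin :: "'a set \<Rightarrow> ('a \<Rightarrow> real) \<Rightarrow> ('a \<Rightarrow> int) \<Rightarrow> real" where
  "lin N p z = (\<Sum>i\<in>N. p i * real_of_int (z i))"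

lemma lin_compl: "lin N p w + lin N p (x + y - w) = lin N p x + lin N p y"
  unfolding lin_def by (simp add: sum.distrib[symmetric] algebra_simps)

lemma lin_adjacent:
  assumes "finite N" "i \<in> N" "\<And>k. k \<noteq> i \<Longrightarrow> u k = x k"
  shows "lin N p u - lin N p x = p i * real_of_int (u i - x i)"
proof -
  have "lin N p u - lin N p x = (\<Sum>k\<in>N. p k * real_of_int (u k - x k))"
    unfolding lin_def by (simp add: sum_subtractf[symmetric] algebra_simps)
  also have "\<dots> = (\<Sum>k\<in>N. if k = i then p i * real_of_int (u i - x i) else 0)"
    by (rule sum.cong) (auto simp: assms(3))
  finally show ?thesis using assms by simp
qed

lemma exch_lin: "exch D (\<lambda>z. f z + lin N p z) x y w \<longleftrightarrow> exch D f x y w"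
  using lin_compl[of N p w x y] unfolding exch_def by auto

lemma adjacent_between_eq:
  assumes "between u w y" "\<bar>w i - u i\<bar> = 1" "\<And>k. k \<noteq> i \<Longrightarrow> w k = u k"
  shows "w = u(i := u i + sgn (y i - u i))" "u i \<noteq> y i"
proof -
  have "w i = u i + sgn (y i - u i) \<and> u i \<noteq> y i"
    using assms(1)[unfolded between_def, rule_format, of i] assms(2) by (auto simp: sgn_if)
  then show "w = u(i := u i + sgn (y i - u i))" "u i \<noteq> y i"
    using assms(3) by auto
qed

text \<open>
  If no completion of the first step \<open>u\<close> satisfies the exchange inequality, a linear functional can be
  added to \<open>f\<close> after which no two-step move from \<open>x\<close> through \<open>u\<close> decreases the value, whereas every opposite
  move from \<open>y\<close> strictly increases it. Each completion concerns its own coordinate, so that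
  the coefficients can be chosen independently.
\<close>

lemma tilt:
  assumes "finite N" "D \<subseteq> int_vecs N" "x \<in> D" "y \<in> D" "adjacent x u" "between x u y"
    and viol: "\<And>w. adjacent u w \<Longrightarrow> between u w y \<Longrightarrow> \<not> exch D f x y w"
  obtains p where
    "\<And>w. adjacent u w \<Longrightarrow> between u w y \<Longrightarrow> w \<in> D \<Longrightarrow> f x + lin N p x \<le> f w + lin N p w"
    "\<And>w. adjacent u w \<Longrightarrow> between u w y \<Longrightarrow> x + y - w \<in> D \<Longrightarrow>
       f y + lin N p y < f (x + y - w) + lin N p (x + y - w)"
proof -
  have uN: "u \<in> int_vecs N" using assms int_vecs_between by blast
  obtain j where j: "\<bar>u j - x j\<bar> = 1" "\<And>k. k \<noteq> j \<Longrightarrow> u k = x k"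
    using \<open>adjacent x u\<close> by (rule adjacentE) blast
  have "x \<in> int_vecs N" "y \<in> int_vecs N" using assms(2-4) by auto
  then have jN: "j \<in> N" using j(1) uN by (intro ccontr[of "j \<in> N"]) (auto simp: int_vecs_def)
  define W where "W i = u(i := u i + sgn (y i - u i))" for i
  have "\<exists>q. (W i \<in> D \<longrightarrow> f x \<le> f (W i) + q) \<and> (x + y - W i \<in> D \<longrightarrow> f y < f (x + y - W i) - q)"
    if "u i \<noteq> y i" for i
  proof -
    have "adjacent u (W i)"
      unfolding adjacent_def W_def using that by (intro exI[of _ i]) (auto simp: sgn_if)
    moreover have "between u (W i) y"
      unfolding between_def W_def using that by (auto simp: sgn_if)
    ultimately have nex: "\<not> exch D f x y (W i)" by (rule viol)
    show ?thesis
    proof (cases "W i \<in> D")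
      case True
      then show ?thesis
        using nex unfolding exch_def by (intro exI[of _ "f x - f (W i)"]) auto
    next
      case False
      then show ?thesis
        by (intro exI[of _ "f (x + y - W i) - f y - 1"]) auto
    qed
  qed
  then obtain q where
    q: "\<And>i. u i \<noteq> y i \<Longrightarrow> W i \<in> D \<Longrightarrow> f x \<le> f (W i) + q i"
       "\<And>i. u i \<noteq> y i \<Longrightarrow> x + y - W i \<in> D \<Longrightarrow> f y < f (x + y - W i) - q i"
    by metis
  \<comment> \<open>If the second step may use the first coordinate \<open>j\<close> again, the coefficient of \<open>j\<close> counts
    twice in that move, whence the half; otherwise it can be 0.\<close>
  define c where "c = (if u j = y j then 0 else q j / 2)"
  define p where "p i = (if i = j then c * real_of_int (u j - x j) else
    (q i - c) * real_of_int (sgn (y i - u i)))" for i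
  have dj: "real_of_int (u j - x j) * real_of_int (u j - x j) = 1"
    using j(1) by (metis abs_mult_self of_int_1 of_int_mult mult_1)
  have linW: "lin N p (W i) = lin N p x + q i" if "u i \<noteq> y i" for i
  proof -
    have iN: "i \<in> N" using that uN \<open>y \<in> int_vecs N\<close> by (intro ccontr[of "i \<in> N"]) (auto simp: int_vecs_def)
    have "lin N p (W i) - lin N p u = p i * real_of_int (sgn (y i - u i))"
      using lin_adjacent[OF assms(1) iN, of "W i" u p] by (simp add: W_def)
    moreover have "lin N p u - lin N p x = c"
      using lin_adjacent[OF assms(1) jN, of u x p] j dj by (simp add: p_def)
    moreover have "p i * real_of_int (sgn (y i - u i)) = q i - c"
    proof (cases "i = j")
      case True
      have "sgn (y j - u j) = u j - x j"
        using that True \<open>between x u y\<close>[unfolded between_def, rule_format, of j] j(1)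
        by (auto simp: sgn_if)
      then show ?thesis
        using True that dj by (simp add: p_def c_def)
    next
      case False
      have "real_of_int (sgn (y i - u i)) * real_of_int (sgn (y i - u i)) = 1"
        using that by (auto simp: sgn_if)
      then show ?thesis using False by (simp add: p_def)
    qed
    ultimately show ?thesis by simp
  qed
  have eqW: "\<exists>i. u i \<noteq> y i \<and> w = W i" if w: "adjacent u w" "between u w y" for w
  proof -
    obtain i where "\<bar>w i - u i\<bar> = 1" "\<And>k. k \<noteq> i \<Longrightarrow> w k = u k"
      using w(1) by (rule adjacentE) blast
    from adjacent_between_eq[OF w(2) this] show ?thesis unfolding W_def by blast
  qed
  show thesis
  proof (rule that[of p])
    fix w assume "adjacent u w" "between u w y"
    then obtain i where i: "u i \<noteq> y i" "w = W i" using eqW by blast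
    show "f x + lin N p x \<le> f w + lin N p w" if "w \<in> D"
      using q(1)[of i] linW[of i] i that by simp
    show "f y + lin N p y < f (x + y - w) + lin N p (x + y - w)" if "x + y - w \<in> D"
      using q(2)[of i] linW[of i] i that lin_compl[of N p w x y] by simp
  qed
qed

lemma one_sided_two_steps:
  assumes "finite N" "D \<subseteq> int_vecs N" "one_sided D" "x \<in> D" "y \<in> D" "x \<noteq> y"
  obtains z where "z \<in> D" "between x z y" "l1 N x z = 2"
proof -
  obtain u where u: "adjacent x u" "between x u y"
    using \<open>x \<noteq> y\<close> by (rule adjacent_exists)
  then obtain w where w: "w \<in> D" "adjacent u w" "between u w y"
    using assms unfolding one_sided_def by blast
  have "u \<in> int_vecs N" "w \<in> int_vecs N"
    using int_vecs_between[OF u(2)] w(1) assms by auto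
  then have "l1 N x u = 1" "l1 N u w = 1"
    using assms u w l1_adjacent by (metis subsetD)+
  moreover have "between x w y" "between x u w"
    using between_trans u w by blast+
  ultimately show ?thesis
    using that[OF w(1)] l1_between[of x u w N] by simp
qed

text \<open>
  Local exchange implies global exchange. Take a violating pair \<open>(x, y)\<close> with first step \<open>u\<close> at the
  smallest possible distance and tilt \<open>f\<close> as above to obtain \<open>h\<close>. Among the domain
  vectors two steps away from \<open>y\<close> that have not used up the step \<open>u\<close>, let \<open>y'\<close> minimise \<open>h\<close>. The pair
  \<open>(x, y')\<close> is closer, so it admits an exchange with first step \<open>u\<close>; as \<open>x\<close> cannot decrease,
  the new second vector \<open>z\<close> satisfies \<open>h z \<le> h y'\<close>. Now \<open>z\<close> and \<open>y\<close> are at distance 4. The local exchange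
  between them produces one vector that undoes the step \<open>u\<close> at \<open>y\<close>, whose value exceeds \<open>h y\<close>, and one that
  competes with \<open>y'\<close>, whose value is at least \<open>h y'\<close>; their sum is too large.
\<close>

theorem local_to_global:
  assumes "finite N" "finite D" "D \<subseteq> int_vecs N" "one_sided D" "midpoint N D f"
  shows "jump_M D f"
proof -
  have "\<exists>w. adjacent u w \<and> between u w y \<and> exch D f x y w"
    if "x \<in> D" "y \<in> D" "adjacent x u" "between x u y" "l1 N x y = n" for n x y u
    using that
  proof (induction n arbitrary: x y u rule: less_induct)
    case (less n)
    note xD = \<open>x \<in> D\<close> and yD = \<open>y \<in> D\<close> and xu = \<open>adjacent x u\<close> and xuy = \<open>between x u y\<close>
    have N: "z \<in> int_vecs N" if "z \<in> D" for z using that assms by blast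
    have uN: "u \<in> int_vecs N" using int_vecs_between xuy N xD yD by blast
    have l1u: "l1 N x u = 1" using l1_adjacent[OF assms(1) N[OF xD] uN] xu by simp
    obtain w0 where w0: "w0 \<in> D" "adjacent u w0" "between u w0 y"
      using assms(4) xD yD xu xuy unfolding one_sided_def by blast
    have l1w0: "l1 N u w0 = 1" using l1_adjacent[OF assms(1) uN N] w0 by simp
    have l1uy: "1 + l1 N u y = n" "1 + l1 N w0 y = l1 N u y"
      using l1_between[OF xuy, of N] l1_between[OF w0(3), of N] l1u l1w0 less.prems(5) by auto
    show ?case
    proof (cases "n = 2")
      case True
      then have "w0 = y"
        using l1uy l1_0[OF assms(1) _ N[OF w0(1)] N[OF yD]] by simp
      then show ?thesis
        using w0 xD yD unfolding exch_def by (intro exI[of _ y]) (auto simp: add.commute)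
    next
      case False
      then have n3: "n \<ge> 3" using l1uy by linarith
      obtain j where j: "\<bar>u j - x j\<bar> = 1" "\<And>k. k \<noteq> j \<Longrightarrow> u k = x k"
        using xu by (rule adjacentE) blast
      have xjyj: "x j \<noteq> y j"
        using xuy[unfolded between_def, rule_format, of j] j(1) by auto
      show ?thesis
      proof (rule ccontr)
        assume "\<not> ?thesis"
        then have viol: "\<And>w. adjacent u w \<Longrightarrow> between u w y \<Longrightarrow> \<not> exch D f x y w" by blast
        obtain p where p:
          "\<And>w. adjacent u w \<Longrightarrow> between u w y \<Longrightarrow> w \<in> D \<Longrightarrow> f x + lin N p x \<le> f w + lin N p w"
          "\<And>w. adjacent u w \<Longrightarrow> between u w y \<Longrightarrow> x + y - w \<in> D \<Longrightarrow>
             f y + lin N p y < f (x + y - w) + lin N p (x + y - w)"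
          using tilt[OF assms(1,3) xD yD xu xuy viol] by blast
        define h where "h z = f z + lin N p z" for z
        have exch_h: "exch D h a b w \<longleftrightarrow> exch D f a b w" for a b w
          unfolding h_def exch_lin ..
        define C where "C = {z \<in> D. between u z y \<and> l1 N z y = 2}"
        \<comment> \<open>If two steps from \<open>y\<close> reach \<open>z\<close> with \<open>z j = x j\<close>, then two further steps and a local exchange
          yield two opposite vectors, of which at least one differs from \<open>x\<close> in coordinate \<open>j\<close>.\<close>
        have "C \<noteq> {}"
        proof -
          obtain z where z: "z \<in> D" "between y z x" "l1 N y z = 2"
            using one_sided_two_steps[OF assms(1,3,4) yD xD] xjyj by metis
          show ?thesis
          proof (cases "z j = x j")
            case False
            then show ?thesis
              using z(1,3) between_step(1)[OF xuy z(2)[unfolded between_sym[of y]] j] l1_sym[of N y z]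
              unfolding C_def by auto
          next
            case True
            have "z \<noteq> x"
              using z less.prems(5) n3 by (auto simp: l1_sym)
            then obtain z' where z': "z' \<in> D" "between z z' x" "l1 N z z' = 2"
              using one_sided_two_steps[OF assms(1,3,4) z(1) xD] by metis
            have b: "between y z' x" "between y z z'"
              using between_trans[OF z(2) z'(2)] by auto
            have "l1 N z' y = 4"
              using l1_between[OF b(2), of N] z z' by (simp add: l1_sym)
            then obtain m where m: "l1 N z' m = 2" "between z' m y" "exch D f z' y m"
              using assms(5) z'(1) yD unfolding midpoint_def by blast
            let ?m' = "z' + y - m"
            have zj: "z' j = x j"
              using z'(2)[unfolded between_def, rule_format, of j] True by auto
            have xz'y: "between x z' y" using b(1) by (simp only: between_sym[of y])
            have "between x m y" "between x ?m' y"
              using between_trans(1)[OF xz'y m(2)] between_trans(1)[OF xz'y between_compl[OF m(2)]] by auto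
            moreover have "m j \<noteq> x j \<or> ?m' j \<noteq> x j"
              using zj xjyj by auto
            moreover have "l1 N m y = 2" "l1 N ?m' y = 2"
              using l1_between[OF m(2), of N] m(1) \<open>l1 N z' y = 4\<close> by (auto simp: l1_compl)
            ultimately have "m \<in> C \<or> ?m' \<in> C"
              using between_step(1)[OF xuy _ j] m(3) unfolding C_def exch_def by blast
            then show ?thesis by blast
          qed
        qed
        moreover have "finite C" using assms(2) unfolding C_def by simp
        ultimately obtain y' where y': "y' \<in> C" and y'min: "\<And>z. z \<in> C \<Longrightarrow> h y' \<le> h z"
          using arg_min_if_finite(1)[of C h] arg_min_least[of C _ h] by blast
        have y'D: "y' \<in> D" and uy'y: "between u y' y" and l1y': "l1 N y' y = 2"
          using y' unfolding C_def by auto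
        have xy'y: "between x y' y" and xuy': "between x u y'"
          using between_trans[OF xuy uy'y] by auto
        have "l1 N x y' < n"
          using l1_between[OF xy'y, of N] l1y' less.prems(5) by simp
        then obtain w where w: "adjacent u w" "between u w y'" "exch D f x y' w"
          using less.IH[OF _ xD y'D xu xuy' refl] by blast
        define z where "z = x + y' - w"
        have wD: "w \<in> D" and zD: "z \<in> D" and hz: "h w + h z \<le> h x + h y'"
          using w(3) exch_h[of x y' w] unfolding exch_def z_def by auto
        have uwy: "between u w y"
          using between_trans'[OF uy'y w(2)] by simp
        have "h x \<le> h w"
          using p(1)[OF w(1) uwy wD] by (simp add: h_def)
        then have hz': "h z \<le> h y'" using hz by simp
        have xwy': "between x w y'" and xuw: "between x u w"
          using between_trans[OF xuy' w(2)] by auto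
        have "l1 N x w = 2"
          using l1_between[OF xuw, of N] l1u l1_adjacent[OF assms(1) uN N[OF wD]] w(1) by simp
        then have "l1 N z y' = 2" by (simp add: z_def l1_compl)
        have xzy': "between x z y'" unfolding z_def using xwy' by (rule between_compl)
        have zy'y: "between z y' y" and xzy: "between x z y"
          using between_trans'[OF xy'y xzy'] by auto
        have "l1 N z y = 4"
          using l1_between[OF zy'y, of N] \<open>l1 N z y' = 2\<close> l1y' by simp
        then obtain m where m: "l1 N z m = 2" "between z m y" "exch D h z y m"
          using assms(5) zD yD exch_h unfolding midpoint_def by metis
        \<comment> \<open>One of \<open>m\<close> and its opposite vector has moved away from \<open>y\<close> in the coordinate of the first
          step; call it \<open>m\<close>. It yields a contradiction.\<close>
        have key: False if m: "l1 N z m = 2" "between z m y" "exch D h z y m" "m j \<noteq> y j" for m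
        proof -
          define k where "k = z + y - m"
          define \<omega> where "\<omega> = x + y - m"
          have mD: "m \<in> D" and kD: "k \<in> D" and le: "h m + h k \<le> h z + h y"
            using m(3) unfolding exch_def k_def by auto
          have zky: "between z k y" unfolding k_def using m(2) by (rule between_compl)
          have xmy: "between x m y" and xky: "between x k y" and xzk: "between x z k"
            using between_trans[OF xzy] m(2) zky by auto
          have "k j \<noteq> z j" using m(4) by (simp add: k_def)
          then have "k j \<noteq> x j"
            using xzk[unfolded between_def, rule_format, of j] by auto
          then have "between u k y" using between_step(1)[OF xuy xky j] by simp
          moreover have "l1 N k y = 2" using m(1) by (simp add: k_def l1_compl)
          ultimately have "h y' \<le> h k" using kD y'min unfolding C_def by simp
          have x\<omega>y: "between x \<omega> y" unfolding \<omega>_def using xmy by (rule between_compl)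
          have "\<omega> j \<noteq> x j" using m(4) by (simp add: \<omega>_def)
          then have u\<omega>: "between u \<omega> y" "between x u \<omega>"
            using between_step[OF xuy x\<omega>y j] by auto
          have "l1 N m y = 2"
            using l1_between[OF m(2), of N] m(1) \<open>l1 N z y = 4\<close> by simp
          then have "l1 N x \<omega> = 2" by (simp add: \<omega>_def l1_compl)
          then have "l1 N u \<omega> = 1" using l1_between[OF u\<omega>(2), of N] l1u by simp
          then have "adjacent u \<omega>"
            using l1_adjacent[OF assms(1) uN] int_vecs_between[OF x\<omega>y N[OF xD] N[OF yD]] by simp
          moreover have "x + y - \<omega> = m" by (simp add: \<omega>_def)
          ultimately have "h y < h m"
            using p(2)[OF _ u\<omega>(1)] mD by (simp add: h_def)
          then show False using le \<open>h y' \<le> h k\<close> hz' by simp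
        qed
        have "z j \<noteq> y j"
        proof -
          have "w j \<noteq> x j"
            using xuw[unfolded between_def, rule_format, of j] j(1) by auto
          then have "z j \<noteq> y' j" by (simp add: z_def)
          then show ?thesis
            using zy'y[unfolded between_def, rule_format, of j] by auto
        qed
        then have "m j \<noteq> y j \<or> (z + y - m) j \<noteq> y j" by auto
        moreover have "l1 N z (z + y - m) = 2"
          using l1_between[OF m(2), of N] m(1) \<open>l1 N z y = 4\<close> by (simp add: l1_compl)
        moreover have "between z (z + y - m) y" using m(2) by (rule between_compl)
        moreover have "exch D h z y (z + y - m)" using m(3) exch_compl by blast
        ultimately show False using key m by blast
      qed
    qed
  qed
  then show ?thesis unfolding jump_M_def by blast
qed

section \<open>Local exchange from a pivot coordinate\<close>

text \<open>
  Signed unit vectors; these are the differences of adjacent vectors.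
\<close>

definition is_unit :: "('a \<Rightarrow> int) \<Rightarrow> bool" where
  "is_unit r \<longleftrightarrow> (\<exists>i. \<bar>r i\<bar> = 1 \<and> (\<forall>k. k \<noteq> i \<longrightarrow> r k = 0))"

lemma adjacent_unit: "adjacent x (x + r) \<longleftrightarrow> is_unit r" "adjacent (x + r) x \<longleftrightarrow> is_unit r"
  "adjacent (x - r) x \<longleftrightarrow> is_unit r" "adjacent x (x - r) \<longleftrightarrow> is_unit r"
  unfolding adjacent_def is_unit_def by auto

text \<open>
  A vector difference of \<open>l1\<close> norm \<open>n\<close> is a sum of \<open>n\<close> signed unit vectors without cancellation. Repetitions
  are permitted, and keeping the summands labelled makes it unnecessary to treat them separately.
\<close>

lemma unit_decomposition:
  fixes x y :: "'a \<Rightarrow> int"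
  assumes "finite N" "x \<in> int_vecs N" "y \<in> int_vecs N" "l1 N x y = n"
  shows "\<exists>r :: nat \<Rightarrow> 'a \<Rightarrow> int. (\<forall>k<n. is_unit (r k) \<and> (\<forall>i. r k i = 0 \<or> r k i = sgn (y i - x i))) \<and>
    (\<forall>i. y i - x i = (\<Sum>k<n. r k i))"
  using assms(2,4)
proof (induction n arbitrary: x)
    case 0
    then have "x = y" using l1_0 assms by blast
    then show ?case by simp
  next
    case (Suc n)
    then have "x \<noteq> y" by auto
    then obtain u where u: "adjacent x u" "between x u y" by (rule adjacent_exists)
    have uN: "u \<in> int_vecs N" using int_vecs_between[OF u(2) Suc.prems(1) assms(3)] .
    have "l1 N u y = n"
      using l1_between[OF u(2), of N] l1_adjacent[OF assms(1) Suc.prems(1) uN] u(1) Suc.prems(2)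
      by simp
    then obtain r where r: "\<And>k. k < n \<Longrightarrow> is_unit (r k)"
      "\<And>k i. k < n \<Longrightarrow> r k i = 0 \<or> r k i = sgn (y i - u i)" "\<And>i. y i - u i = (\<Sum>k<n. r k i)"
      using Suc.IH[OF uN] by blast
    obtain j where j: "\<bar>u j - x j\<bar> = 1" "\<And>k. k \<noteq> j \<Longrightarrow> u k = x k"
      using u(1) by (rule adjacentE) blast
    have sg: "sgn (y i - u i) = 0 \<or> sgn (y i - u i) = sgn (y i - x i)" for i
      using u(2)[unfolded between_def, rule_format, of i] by (auto simp: sgn_if)
    have ux: "u i - x i = 0 \<or> u i - x i = sgn (y i - x i)" for i
      using u(2)[unfolded between_def, rule_format, of i] j by (cases "i = j") (auto simp: sgn_if)
    have "is_unit (u - x)" using u(1) adjacent_unit(1)[of x "u - x"] by simp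
    moreover have "r k i = 0 \<or> r k i = sgn (y i - x i)" if "k < n" for k i
      using r(2)[OF that, of i] sg[of i] by auto
    moreover have "y i - x i = (\<Sum>k<n. r k i) + (u i - x i)" for i
      using r(3)[of i] by simp
    moreover have "(\<Sum>k<Suc n. (r(n := u - x)) k i) = (\<Sum>k<n. r k i) + (u i - x i)" for i
      by (auto intro!: sum.cong)
    ultimately have "\<forall>k<Suc n. is_unit ((r(n := u - x)) k) \<and>
        (\<forall>i. (r(n := u - x)) k i = 0 \<or> (r(n := u - x)) k i = sgn (y i - x i))"
      "\<forall>i. y i - x i = (\<Sum>k<Suc n. (r(n := u - x)) k i)"
      using r(1) ux by (auto simp only: less_Suc_eq fun_upd_apply fun_diff_def split: if_splits)
    then show ?case by blast
qed

text \<open>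
  If \<open>y - x\<close> is a cancellation-free sum of unit vectors (\<open>s\<close> prescribes the signs), every step from \<open>x\<close> towards
  \<open>y\<close> is one of the summands.
\<close>

lemma adjacent_eq_unit:
  assumes "finite K" "\<And>k. k \<in> K \<Longrightarrow> is_unit (r k)" "\<And>k i. k \<in> K \<Longrightarrow> r k i = 0 \<or> r k i = s i"
    "\<And>i. y i - x i = (\<Sum>k\<in>K. r k i)" "adjacent x w" "between x w y"
  obtains k where "k \<in> K" "w = x + r k"
proof -
  obtain j where j: "\<bar>w j - x j\<bar> = 1" "\<And>k. k \<noteq> j \<Longrightarrow> w k = x k"
    using assms(5) by (rule adjacentE) blast
  have "(\<Sum>k\<in>K. r k j) \<noteq> 0"
    using assms(6)[unfolded between_def, rule_format, of j] j(1) assms(4)[of j] by auto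
  then obtain k where k: "k \<in> K" "r k j \<noteq> 0"
    by (meson sum.neutral)
  obtain i where i: "\<bar>r k i\<bar> = 1" "\<And>l. l \<noteq> i \<Longrightarrow> r k l = 0"
    using assms(2)[OF k(1)] unfolding is_unit_def by blast
  have "i = j" using i(2)[of j] k(2) by auto
  then have rj: "\<bar>r k j\<bar> = 1" "r k j = s j" using i(1) assms(3)[OF k(1), of j] k(2) by auto
  have "0 \<le> (\<Sum>k\<in>K. s j * r k j)"
  proof (rule sum_nonneg)
    show "0 \<le> s j * r k j" if "k \<in> K" for k
      using assms(3)[OF that, of j] by auto
  qed
  then have "0 \<le> s j * (y j - x j)" by (simp add: assms(4) sum_distrib_left)
  then have "w j - x j = r k j"
    using assms(6)[unfolded between_def, rule_format, of j] j(1) rj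
    by (auto simp: abs_if split: if_splits)
  then have "w l = x l + r k l" for l
    using j(2)[of l] i(2)[of l] \<open>i = j\<close> by (cases "l = j") auto
  then have "w = x + r k" by auto
  then show ?thesis using that k(1) by blast
qed

text \<open>
  Let \<open>h i j\<close> be the value of \<open>f\<close> at the midpoint reached by the unit steps \<open>i\<close> and \<open>j\<close>, and let \<open>G i j\<close> say that
  this midpoint is in the domain. If every pair of opposite midpoints has value sum above \<open>L\<close>, then
  weights \<open>p i\<close> of total 0 on the four steps raise all midpoints strictly above \<open>L / 2\<close>. This works because
  the three weights \<open>p 0 + p 1\<close>, \<open>p 0 + p 2\<close>, \<open>p 0 + p 3\<close> can be prescribed freely, one for each opposite pair.
\<close>

lemma four_potential:
  fixes h :: "nat \<Rightarrow> nat \<Rightarrow> real" and G :: "nat \<Rightarrow> nat \<Rightarrow> bool"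
  assumes sym: "\<And>i j. h i j = h j i" "\<And>i j. G i j = G j i"
    and viol: "\<And>i j k l. {i, j, k, l} = {..<4} \<Longrightarrow> G i j \<Longrightarrow> G k l \<Longrightarrow> L < h i j + h k l"
  obtains p :: "nat \<Rightarrow> real" where
    "(\<Sum>i<4. p i) = 0" "\<And>i j. i < 4 \<Longrightarrow> j < 4 \<Longrightarrow> i \<noteq> j \<Longrightarrow> G i j \<Longrightarrow> L / 2 < h i j + p i + p j"
proof -
  have sel: "\<exists>t. (G i j \<longrightarrow> L / 2 < h i j + t) \<and> (G k l \<longrightarrow> L / 2 < h k l - t)"
    if "{i, j, k, l} = {..<4}" for i j k l
  proof (cases "G i j")
    case True
    show ?thesis
    proof (cases "G k l")
      case True
      then show ?thesis
        using viol[OF that \<open>G i j\<close> True] by (intro exI[of _ "(h k l - h i j) / 2"]) (auto simp: field_simps)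
    next
      case False
      then show ?thesis by (intro exI[of _ "L / 2 - h i j + 1"]) auto
    qed
  next
    case False
    then show ?thesis by (intro exI[of _ "h k l - L / 2 - 1"]) auto
  qed
  have e: "{0, 1, 2, 3} = {..<4 :: nat}" "{0, 2, 1, 3} = {..<4 :: nat}" "{0, 3, 1, 2} = {..<4 :: nat}"
    by auto
  obtain \<alpha> where \<alpha>: "G 0 1 \<longrightarrow> L / 2 < h 0 1 + \<alpha>" "G 2 3 \<longrightarrow> L / 2 < h 2 3 - \<alpha>"
    using sel[OF e(1)] by blast
  obtain \<beta> where \<beta>: "G 0 2 \<longrightarrow> L / 2 < h 0 2 + \<beta>" "G 1 3 \<longrightarrow> L / 2 < h 1 3 - \<beta>"
    using sel[OF e(2)] by blast
  obtain \<gamma> where \<gamma>: "G 0 3 \<longrightarrow> L / 2 < h 0 3 + \<gamma>" "G 1 2 \<longrightarrow> L / 2 < h 1 2 - \<gamma>"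
    using sel[OF e(3)] by blast
  define p :: "nat \<Rightarrow> real" where "p i = (if i = 0 then \<alpha> + \<beta> + \<gamma> else if i = 1 then \<alpha> - \<beta> - \<gamma>
    else if i = 2 then \<beta> - \<alpha> - \<gamma> else \<gamma> - \<alpha> - \<beta>) / 2" for i
  have four: "i = 0 \<or> i = 1 \<or> i = 2 \<or> i = 3" if "i < 4" for i :: nat
    using that by auto
  show thesis
  proof (rule that[of p])
    show "(\<Sum>i<4. p i) = 0"
    proof -
      have "(\<Sum>i<4. p i) = p 0 + p 1 + p 2 + p 3" by (simp add: eval_nat_numeral)
      also have "\<dots> = 0" by (simp add: p_def field_simps)
      finally show ?thesis .
    qed
    have pv: "p 0 = (\<alpha> + \<beta> + \<gamma>) / 2" "p 1 = (\<alpha> - \<beta> - \<gamma>) / 2" "p 2 = (\<beta> - \<alpha> - \<gamma>) / 2"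
      "p 3 = (\<gamma> - \<alpha> - \<beta>) / 2"
      by (simp_all add: p_def)
    define R where "R i j \<longleftrightarrow> (G i j \<longrightarrow> L / 2 < h i j + p i + p j)" for i j
    have "R 0 1" "R 2 3" "R 0 2" "R 1 3" "R 0 3" "R 1 2"
      unfolding R_def pv using \<alpha> \<beta> \<gamma> by argo+
    moreover have "R j i" if "R i j" for i j
      using that sym[of i j] by (simp add: R_def add_ac)
    ultimately have "R i j" if "i < 4" "j < 4" "i \<noteq> j" for i j
      using four[OF that(1)] four[OF that(2)] that(3) by metis
    then show "L / 2 < h i j + p i + p j" if "i < 4" "j < 4" "i \<noteq> j" "G i j" for i j
      using that by (simp add: R_def)
  qed
qed

text \<open>
  Suppose the two ends of a distance-4 pair have values \<open>c\<close> and \<open>d\<close> and all opposite midpoints have value sum above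
  \<open>c + d\<close>. Shift both ends to a parallel layer, let \<open>a m\<close> and \<open>b m\<close> be the values at the vectors
  of that layer one step \<open>m\<close> away from the first and from the second end, towards the other one, and let \<open>P\<close> and
  \<open>Q\<close> be the indices for which these vectors are in the domain. The hypotheses say
  that a vector of the layer and the end farther from it can be exchanged for a midpoint and a vector
  of the layer close to that end. After normalisation by \<open>four_potential\<close> each such exchange
  strictly decreases the value on the layer. A finite layer therefore has to be empty.
\<close>

lemma four_point_descent:
  fixes h :: "nat \<Rightarrow> nat \<Rightarrow> real" and G :: "nat \<Rightarrow> nat \<Rightarrow> bool" and a b :: "nat \<Rightarrow> real"
  assumes sym: "\<And>i j. h i j = h j i" "\<And>i j. G i j = G j i"
    and viol: "\<And>i j k l. {i, j, k, l} = {..<4} \<Longrightarrow> G i j \<Longrightarrow> G k l \<Longrightarrow> c + d < h i j + h k l"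
    and P: "P \<subseteq> {..<4}" "Q \<subseteq> {..<4}"
    and ab: "\<And>m. m \<in> P \<Longrightarrow> \<exists>k\<in>Q - {m}. G m k \<and> b k + h m k \<le> d + a m"
    and ba: "\<And>m. m \<in> Q \<Longrightarrow> \<exists>k i j. k \<in> P \<and> {m, k, i, j} = {..<4} \<and> G i j \<and> a k + h i j \<le> c + b m"
  shows "P = {}"
proof (rule ccontr)
  obtain p where p: "(\<Sum>i<4. p i) = 0"
    "\<And>i j. i < 4 \<Longrightarrow> j < 4 \<Longrightarrow> i \<noteq> j \<Longrightarrow> G i j \<Longrightarrow> (c + d) / 2 < h i j + p i + p j"
    using four_potential[of h G "c + d", OF sym viol] by blast
  define A where "A m = a m + p m + (d - c) / 2" for m
  define B where "B m = b m - p m" for m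
  have AB: "\<exists>k\<in>Q. B k < A m" if m: "m \<in> P" for m
  proof -
    obtain k where k: "k \<in> Q" "k \<noteq> m" "G m k" "b k + h m k \<le> d + a m"
      using ab[OF m] by blast
    have "(c + d) / 2 < h m k + p m + p k"
      using p(2)[of m k] k m P by auto
    then show ?thesis using k(1,4) by (intro bexI[of _ k]) (auto simp: A_def B_def field_simps)
  qed
  have BA: "\<exists>k\<in>P. A k < B m" if m: "m \<in> Q" for m
  proof -
    obtain k i j where k: "k \<in> P" "{m, k, i, j} = {..<4}" "G i j" "a k + h i j \<le> c + b m"
      using ba[OF m] by blast
    have "card {m, k, i, j} = 4" using k(2) by simp
    then have dist: "m \<noteq> k" "m \<noteq> i" "m \<noteq> j" "k \<noteq> i" "k \<noteq> j" "i \<noteq> j"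
      by (auto simp: card_insert_if split: if_splits)
    then have "(\<Sum>i\<in>{m, k, i, j}. p i) = p m + p k + p i + p j" by simp
    then have "p m + p k + p i + p j = 0" using p(1) k(2) by simp
    moreover have "(c + d) / 2 < h i j + p i + p j"
      using p(2)[of i j] k dist by (metis insertCI lessThan_iff)
    ultimately show ?thesis using k(1,4) by (intro bexI[of _ k]) (auto simp: A_def B_def field_simps)
  qed
  assume "P \<noteq> {}"
  have fin: "finite P" using P finite_subset by blast
  define m where "m = arg_min_on A P"
  have m: "m \<in> P" "\<And>k. k \<in> P \<Longrightarrow> A m \<le> A k"
    using arg_min_if_finite(1)[OF fin \<open>P \<noteq> {}\<close>, of A] arg_min_least[OF fin \<open>P \<noteq> {}\<close>, of _ A]
    unfolding m_def by auto
  obtain k where k: "k \<in> Q" "B k < A m" using AB[OF m(1)] by blast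
  obtain l where "l \<in> P" "A l < B k" using BA[OF k(1)] by blast
  then show False using m(2)[of l] k(2) by simp
qed

lemma l1_translate: "l1 N (x + q) (y + q) = l1 N x y"
  by (simp add: l1_def)

text \<open>
  The exchange property at distance 4, restricted to first steps in the coordinate \<open>a\<close>.
\<close>

definition coord_exch ::
  "'a set \<Rightarrow> 'a \<Rightarrow> ('a \<Rightarrow> int) set \<Rightarrow> (('a \<Rightarrow> int) \<Rightarrow> real) \<Rightarrow> bool" where
  "coord_exch N a D f \<longleftrightarrow> (\<forall>x\<in>D. \<forall>y\<in>D. \<forall>v. l1 N x y = 4 \<and> adjacent x v \<and> between x v y \<and> v a \<noteq> x a \<longrightarrow>
     (\<exists>w. adjacent v w \<and> between v w y \<and> exch D f x y w))"

text \<open>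
  Exchange between \<open>x\<close> and a vector \<open>u\<close> that is reached from \<open>x\<close> by the unit step \<open>q\<close> in coordinate \<open>a\<close> and three
  unit steps \<open>r k\<close> in other coordinates.
\<close>

lemma coord_exch_units:
  assumes N: "finite N" "D \<subseteq> int_vecs N" and cx: "coord_exch N a D f" and "x \<in> D" "u \<in> D"
    and K: "finite K" "\<And>k. k \<in> K \<Longrightarrow> is_unit (r k)" "\<And>k i. k \<in> K \<Longrightarrow> r k i = 0 \<or> r k i = s i"
      "\<And>k. k \<in> K \<Longrightarrow> r k a = 0"
    and q: "is_unit q" "q a \<noteq> 0"
    and u: "\<And>i. u i - (x + q) i = (\<Sum>k\<in>K. r k i)" "l1 N (x + q) u = 3"
  obtains k where "k \<in> K" "x + q + r k \<in> D" "u - q - r k \<in> D"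
    "f (x + q + r k) + f (u - q - r k) \<le> f x + f u"
proof -
  have qi: "q i = 0" if "i \<noteq> a" for i using q that unfolding is_unit_def by metis
  have "u a = x a + q a" using u(1)[of a] K(4) by simp
  then have b: "between x (x + q) u"
    unfolding between_def using qi by (metis add.right_neutral linear order_refl plus_fun_apply)
  have adj: "adjacent x (x + q)" using q(1) adjacent_unit by blast
  have "x + q \<in> int_vecs N" using int_vecs_between[OF b] N assms(4,5) by blast
  then have "l1 N x (x + q) = 1" using l1_adjacent[of N x "x + q"] adj N assms(4) by blast
  then have "l1 N x u = 4" using l1_between[OF b, of N] u(2) by simp
  then obtain w where w: "adjacent (x + q) w" "between (x + q) w u" "exch D f x u w"
    using cx assms(4,5) adj b q(2) unfolding coord_exch_def by fastforce
  obtain k where k: "k \<in> K" "w = x + q + r k"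
    using adjacent_eq_unit[OF K(1-3) u(1) w(1,2)] by blast
  have eq: "x + u - (x + q + r k) = u - q - r k" by simp
  show ?thesis
    using w(3) unfolding exch_def k(2) eq by (intro that[OF k(1)]) blast+
qed

lemma sum_lessThan_4: "{i, j, k, l} = {..<4} \<Longrightarrow> (\<Sum>m<4. g m) = g i + g j + g k + (g l :: 'b::comm_monoid_add)"
  for i j k l :: nat
proof -
  assume eq: "{i, j, k, l} = {..<4}"
  then have "card {i, j, k, l} = 4" by simp
  then have "i \<noteq> j" "i \<noteq> k" "i \<noteq> l" "j \<noteq> k" "j \<noteq> l" "k \<noteq> l"
    by (auto simp: card_insert_if split: if_splits)
  then show ?thesis unfolding eq[symmetric] by (simp add: add.assoc)
qed

lemma lessThan_4_complement:
  fixes m k :: nat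
  assumes "m < 4" "k < 4" "m \<noteq> k"
  obtains i j where "{m, k, i, j} = {..<4}"
proof -
  have "card ({..<4} - {m, k}) = 2" using assms by (simp add: card_Diff_subset)
  then obtain i j where "{..<4} - {m, k} = {i, j}" by (auto simp: card_2_iff)
  then have "{m, k, i, j} = {..<4}" using assms by auto
  then show ?thesis by (rule that)
qed

text \<open>
  Criterion for local exchange. It suffices to have exchange for first steps in a single coordinate \<open>a\<close>, provided
  that every pair at distance 4 that violates local exchange and agrees in coordinate \<open>a\<close> comes with a domain
  vector reached by one step towards the other end and one step in coordinate \<open>a\<close>. That vector
  belongs to the layer shifted by a unit in coordinate \<open>a\<close>, to which \<open>four_point_descent\<close> applies.
\<close>

lemma pivot_midpoint:
  fixes D :: "('a \<Rightarrow> int) set"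
  assumes N: "finite N" "D \<subseteq> int_vecs N" and cx: "coord_exch N a D f"
    and pivot: "\<And>x y. x \<in> D \<Longrightarrow> y \<in> D \<Longrightarrow> l1 N x y = 4 \<Longrightarrow> x a = y a \<Longrightarrow>
      \<not> (\<exists>w. l1 N x w = 2 \<and> between x w y \<and> exch D f x y w) \<Longrightarrow>
      \<exists>v u. adjacent x v \<and> between x v y \<and> u \<in> D \<and> adjacent v u \<and> u a \<noteq> v a"
  shows "midpoint N D f"
  unfolding midpoint_def
proof (intro ballI impI)
  fix x y assume xD: "x \<in> D" and yD: "y \<in> D" and l1: "l1 N x y = 4"
  have inN: "z \<in> int_vecs N" if "z \<in> D" for z using that N by blast
  show "\<exists>w. l1 N x w = 2 \<and> between x w y \<and> exch D f x y w"
  proof (cases "x a = y a")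
    case False
    define v where "v = x(a := x a + sgn (y a - x a))"
    have v: "adjacent x v" "between x v y" "v a \<noteq> x a"
      unfolding adjacent_def between_def v_def using False
      by (auto simp: sgn_if intro!: exI[of _ a])
    then obtain w where w: "adjacent v w" "between v w y" "exch D f x y w"
      using cx xD yD l1 unfolding coord_exch_def by blast
    have vN: "v \<in> int_vecs N" and wN: "w \<in> int_vecs N"
      using int_vecs_between[OF v(2)] inN xD yD w(3) unfolding exch_def by blast+
    have "l1 N x v = 1" "l1 N v w = 1"
      using l1_adjacent[OF N(1)] v(1) w(1) vN wN inN xD by blast+
    moreover have b: "between x w y" "between x v w"
      using between_trans[OF v(2) w(2)] by auto
    ultimately have "l1 N x w = 2"
      using l1_between[OF b(2), of N] by simp
    then show ?thesis using w(3) b(1) by blast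
  next
    case True
    show ?thesis
    proof (rule ccontr)
      assume no: "\<not> ?thesis"
      obtain v u where vu: "adjacent x v" "between x v y" "u \<in> D" "adjacent v u" "u a \<noteq> v a"
        using pivot[OF xD yD l1 True no] by blast
      obtain r :: "nat \<Rightarrow> 'a \<Rightarrow> int" where r: "\<And>k. k < 4 \<Longrightarrow> is_unit (r k)"
        "\<And>k i. k < 4 \<Longrightarrow> r k i = 0 \<or> r k i = sgn (y i - x i)"
        "\<And>i. y i - x i = (\<Sum>k<4. r k i)"
        using unit_decomposition[OF N(1) inN[OF xD] inN[OF yD] l1] by blast
      have ra: "r k a = 0" if "k < 4" for k using r(2)[OF that, of a] True by simp
      define q where "q = u - v"
      have q: "is_unit q" "q a \<noteq> 0"
        using vu(4,5) adjacent_unit(1)[of v q] by (auto simp: q_def)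
      \<comment> \<open>The labels for which the vector next to \<open>x + q\<close>, respectively \<open>y + q\<close>, is in the domain.\<close>
      define P where "P = {m. m < 4 \<and> x + q + r m \<in> D}"
      define Q where "Q = {m. m < 4 \<and> y + q - r m \<in> D}"
      define h where "h i j = f (x + r i + r j)" for i j
      define G where "G i j \<longleftrightarrow> x + r i + r j \<in> D" for i j
      have sum4: "y = x + r i + r j + r k + r l" if "{i, j, k, l} = {..<4}" for i j k l
      proof
        fix m
        show "y m = (x + r i + r j + r k + r l) m"
          using r(3)[of m] sum_lessThan_4[OF that, of "\<lambda>k. r k m"] by simp
      qed
      have bet: "between x (x + r i) y" "between x (x + r i + r j) y"
        "between x (x + r i) (x + r i + r j)" if eq: "{i, j, k, l} = {..<4}" for i j k l
      proof -
        have lt: "i < 4" "j < 4" "k < 4" "l < 4" using eq by auto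
        have "(x m \<le> (x + r i) m \<and> (x + r i) m \<le> y m \<or> y m \<le> (x + r i) m \<and> (x + r i) m \<le> x m) \<and>
          (x m \<le> (x + r i + r j) m \<and> (x + r i + r j) m \<le> y m \<or>
           y m \<le> (x + r i + r j) m \<and> (x + r i + r j) m \<le> x m) \<and>
          (x m \<le> (x + r i) m \<and> (x + r i) m \<le> (x + r i + r j) m \<or>
           (x + r i + r j) m \<le> (x + r i) m \<and> (x + r i) m \<le> x m)" for m
        proof -
          have "y m = x m + r i m + r j m + r k m + r l m"
            using sum4[OF eq] by simp
          then show ?thesis
            using r(2)[OF lt(1), of m] r(2)[OF lt(2), of m] r(2)[OF lt(3), of m] r(2)[OF lt(4), of m]
            by (cases "y m - x m" "0 :: int" rule: linorder_cases) auto
        qed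
        then show "between x (x + r i) y" "between x (x + r i + r j) y"
          "between x (x + r i) (x + r i + r j)"
          unfolding between_def by blast+
      qed
      have l1r: "l1 N x (x + r i) = 1 \<and> x + r i \<in> int_vecs N" if i: "i < 4" for i
      proof -
        obtain j where "j < 4" "j \<noteq> i" using that by (cases "i = 0") (auto intro: that[of 0] that[of 1])
        then obtain k l where "{i, j, k, l} = {..<4}" using lessThan_4_complement i by metis
        from bet(1)[OF this] have "x + r i \<in> int_vecs N"
          using int_vecs_between inN xD yD by blast
        then show ?thesis
          using l1_adjacent[OF N(1) inN[OF xD], of "x + r i"] r(1)[OF i] adjacent_unit(1) by blast
      qed
      have bet1: "between x (x + r i) y" if i: "i < 4" for i
      proof -
        obtain j where "j < 4" "j \<noteq> i" using that by (cases "i = 0") (auto intro: that[of 0] that[of 1])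
        then obtain k l where "{i, j, k, l} = {..<4}" using lessThan_4_complement i by metis
        from bet(1)[OF this] show ?thesis .
      qed
      have l1y: "l1 N (x + r i) y = 3" if i: "i < 4" for i
        using l1_between[OF bet1[OF i], of N] l1 l1r[OF i] by simp
      have P0: "P = {}"
      proof (rule four_point_descent[of h G "f x" "f y" P Q "\<lambda>m. f (y + q - r m)" "\<lambda>m. f (x + q + r m)"])
        show "h i j = h j i" "G i j = G j i" for i j
          by (simp_all add: h_def G_def add.assoc add.commute add.left_commute)
        show "P \<subseteq> {..<4}" "Q \<subseteq> {..<4}" by (auto simp: P_def Q_def)
        show "f x + f y < h i j + h k l" if eq: "{i, j, k, l} = {..<4}" and G: "G i j" "G k l" for i j k l
        proof (rule ccontr)
          assume "\<not> f x + f y < h i j + h k l"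
          moreover have "x + y - (x + r i + r j) = x + r k + r l"
            using sum4[OF eq] by simp
          ultimately have ex: "exch D f x y (x + r i + r j)"
            using G unfolding exch_def G_def h_def by simp
          have i: "i < 4" "j < 4" using eq by auto
          have "x + r i + r j \<in> int_vecs N" using ex inN unfolding exch_def by blast
          then have "l1 N (x + r i) (x + r i + r j) = 1"
            using l1_adjacent[OF N(1), of "x + r i" "x + r i + r j"] l1r[OF i(1)] r(1)[OF i(2)] adjacent_unit(1)
            by blast
          then have "l1 N x (x + r i + r j) = 2"
            using l1_between[OF bet(3)[OF eq], of N] l1r[OF i(1)] by simp
          then show False using no ex bet(2)[OF eq] by blast
        qed
        show "\<exists>k\<in>Q - {m}. G m k \<and> f (y + q - r k) + h m k \<le> f y + f (x + q + r m)"
          if "m \<in> P" for m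
        proof -
          have m: "m < 4" "x + q + r m \<in> D" using that by (auto simp: P_def)
          have "l1 N (y + q) (x + q + r m) = l1 N (y + q) (x + r m + q)"
            by (simp add: add_ac)
          also have "\<dots> = 3" using l1y[OF m(1)] by (simp only: l1_translate l1_sym)
          finally have 3: "l1 N (y + q) (x + q + r m) = 3" .
          have s: "(x + q + r m) i - (y + q) i = (\<Sum>k\<in>{..<4} - {m}. (- r k) i)" for i
            using r(3)[of i] m(1) by (simp add: sum.remove[of "{..<4}" m] sum_negf)
          obtain k where k: "k \<in> {..<4} - {m}" "y + q + - r k \<in> D" "x + q + r m - q - - r k \<in> D"
            "f (y + q + - r k) + f (x + q + r m - q - - r k) \<le> f y + f (x + q + r m)"
          proof (rule coord_exch_units[OF N cx yD m(2), of "{..<4} - {m}" "\<lambda>k. - r k" "\<lambda>i. - sgn (y i - x i)"])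
            show "is_unit (- r k)" if "k \<in> {..<4} - {m}" for k
              using r(1)[of k] that by (simp add: is_unit_def)
            show "(- r k) i = 0 \<or> (- r k) i = - sgn (y i - x i)" if "k \<in> {..<4} - {m}" for k i
              using r(2)[of k i] that by auto
            show "(- r k) a = 0" if "k \<in> {..<4} - {m}" for k using ra[of k] that by simp
          qed (use q s 3 in auto)
          have "x + q + r m - q - - r k = x + r m + r k" by simp
          then show ?thesis
            using k unfolding G_def h_def Q_def by (intro bexI[of _ k]) auto
        qed
        show "\<exists>k i j. k \<in> P \<and> {m, k, i, j} = {..<4} \<and> G i j \<and> f (x + q + r k) + h i j \<le> f x + f (y + q - r m)"
          if "m \<in> Q" for m
        proof -
          have m: "m < 4" "y + q - r m \<in> D" using that by (auto simp: Q_def)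
          have "l1 N (x + q) (y + q - r m) = l1 N (x + q) (x + y - (x + r m) + q)"
            by (simp add: algebra_simps)
          also have "\<dots> = 3" using l1y[OF m(1)] by (simp only: l1_translate l1_compl)
          finally have 3: "l1 N (x + q) (y + q - r m) = 3" .
          have s: "(y + q - r m) i - (x + q) i = (\<Sum>k\<in>{..<4} - {m}. r k i)" for i
            using r(3)[of i] m(1) by (simp add: sum.remove[of "{..<4}" m])
          obtain k where k: "k \<in> {..<4} - {m}" "x + q + r k \<in> D" "y + q - r m - q - r k \<in> D"
            "f (x + q + r k) + f (y + q - r m - q - r k) \<le> f x + f (y + q - r m)"
            by (rule coord_exch_units[OF N cx xD m(2), of "{..<4} - {m}" r "\<lambda>i. sgn (y i - x i)"])
              (use q s 3 r ra in auto)
          then obtain i j where ij: "{m, k, i, j} = {..<4}"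
            using lessThan_4_complement[of m k] m by auto
          have eq: "y + q - r m - q - r k = x + r i + r j"
            by (subst sum4[OF ij]) (simp add: fun_eq_iff)
          have "k \<in> P" using k(1,2) by (simp add: P_def)
          moreover have "G i j" "f (x + q + r k) + h i j \<le> f x + f (y + q - r m)"
            using k(3,4) unfolding G_def h_def eq by blast+
          ultimately show ?thesis using ij by blast
        qed
      qed
      obtain m where m: "m \<in> {..<4}" "v = x + r m"
        by (rule adjacent_eq_unit[of "{..<4}" r "\<lambda>i. sgn (y i - x i)" y x v]) (use r vu in auto)
      have "u = x + q + r m" using m(2) by (simp add: q_def)
      then show False using m(1) vu(3) P0 unfolding P_def by auto
    qed
  qed
qed

section \<open>The parity lift\<close>

text \<open>
  The exchange property (JM\<open>\<natural>\<close>-EXC) for a function with domain \<open>D\<close>: the first step alone may suffice.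
\<close>

definition jump_Mnat :: "('a \<Rightarrow> int) set \<Rightarrow> (('a \<Rightarrow> int) \<Rightarrow> real) \<Rightarrow> bool" where
  "jump_Mnat D f \<longleftrightarrow> (\<forall>x\<in>D. \<forall>y\<in>D. \<forall>u. adjacent x u \<and> between x u y \<longrightarrow>
     exch D f x y u \<or> (\<exists>w. adjacent u w \<and> between u w y \<and> exch D f x y w))"

text \<open>
  The parity of the coordinate sum, as the number 0 or 1.
\<close>

definition pcoord :: "'a set \<Rightarrow> ('a \<Rightarrow> int) \<Rightarrow> int" where
  "pcoord N x = (\<Sum>i\<in>N. x i) mod 2"

text \<open>
  The vector extended by its parity as the additional coordinate \<open>None\<close>. Lifted vectors have even coordinate sum.
\<close>

definition lift_vec :: "'a set \<Rightarrow> ('a \<Rightarrow> int) \<Rightarrow> 'a option \<Rightarrow> int" where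
  "lift_vec N x = case_option (pcoord N x) x"

lemma pcoord_cases: "pcoord N x = 0 \<or> pcoord N x = 1"
  unfolding pcoord_def by presburger

lemma pcoord_eq_iff: "pcoord N x = pcoord N y \<longleftrightarrow> even (l1 N x y)"
proof -
  have "2 dvd \<bar>d\<bar> - d" for d :: int by (cases "d \<ge> 0") auto
  then have "2 dvd (\<Sum>i\<in>N. \<bar>x i - y i\<bar> - (x i - y i))"
    by (intro dvd_sum)
  then obtain k where "(\<Sum>i\<in>N. \<bar>x i - y i\<bar> - (x i - y i)) = 2 * k" by (rule dvdE)
  moreover have "(\<Sum>i\<in>N. \<bar>x i - y i\<bar> - (x i - y i)) = int (l1 N x y) - ((\<Sum>i\<in>N. x i) - (\<Sum>i\<in>N. y i))"
    unfolding l1_def by (simp add: sum_subtractf)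
  ultimately have "int (l1 N x y) = (\<Sum>i\<in>N. x i) - (\<Sum>i\<in>N. y i) + 2 * k" by linarith
  then have "even (int (l1 N x y)) \<longleftrightarrow> even ((\<Sum>i\<in>N. x i) - (\<Sum>i\<in>N. y i))" by simp
  then show ?thesis
    unfolding pcoord_def mod_eq_dvd_iff by simp
qed

text \<open>
  If the parity of \<open>w\<close> is that of \<open>x\<close> or of \<open>y\<close>, then taking the opposite vector commutes with lifting.
\<close>

lemma pcoord_compl:
  assumes "pcoord N w = pcoord N x \<or> pcoord N w = pcoord N y"
  shows "pcoord N x + pcoord N y - pcoord N w = pcoord N (x + y - w)"
proof -
  have "pcoord N (x + y - w) = pcoord N y \<longleftrightarrow> pcoord N x = pcoord N w"
    "pcoord N (x + y - w) = pcoord N x \<longleftrightarrow> pcoord N y = pcoord N w"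
    unfolding pcoord_eq_iff using l1_compl[where N = N and x = x and y = y and w = w]
      l1_sym[of N x "x + y - w"] l1_sym[of N w y] by auto
  then show ?thesis
    using assms by auto
qed

lemma between_option:
  "between (case_option b x) (case_option c z) (case_option d y) \<longleftrightarrow>
     between x z y \<and> (b \<le> c \<and> c \<le> d \<or> d \<le> c \<and> c \<le> b)"
  unfolding between_def by (simp only: split_option_all option.case) blast

lemma adjacent_option:
  "adjacent (case_option b x) (case_option c z) \<longleftrightarrow> \<bar>c - b\<bar> = 1 \<and> z = x \<or> c = b \<and> adjacent x z"
  (is "?L \<longleftrightarrow> ?R")
proof
  assume ?L
  then obtain i where i: "\<bar>case_option c z i - case_option b x i\<bar> = 1"
    "\<And>k. k \<noteq> i \<Longrightarrow> case_option c z k = case_option b x k"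
    by (rule adjacentE) blast
  show ?R
  proof (cases i)
    case None
    then have "z k = x k" for k using i(2)[of "Some k"] by simp
    then show ?thesis using i(1) None by auto
  next
    case (Some j)
    then have "z k = x k" if "k \<noteq> j" for k using i(2)[of "Some k"] that by simp
    then show ?thesis using i(1) i(2)[of None] Some by (auto simp: adjacent_def intro!: exI[of _ j])
  qed
next
  assume ?R
  then show ?L
  proof
    assume "\<bar>c - b\<bar> = 1 \<and> z = x"
    then show ?L unfolding adjacent_def by (intro exI[of _ None]) (auto split: option.split)
  next
    assume a: "c = b \<and> adjacent x z"
    then obtain j where "\<bar>z j - x j\<bar> = 1" "\<And>k. k \<noteq> j \<Longrightarrow> z k = x k"
      using adjacentE by metis
    then show ?L using a unfolding adjacent_def
      by (intro exI[of _ "Some j"]) (auto split: option.split)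
  qed
qed

lemma l1_option:
  assumes "finite N"
  shows "l1 (insert None (Some ` N)) (case_option b x) (case_option c y) = nat \<bar>b - c\<bar> + l1 N x y"
  unfolding l1_def using assms by (simp add: sum.reindex)

lemma compl_option:
  "case_option b x + case_option c y - case_option d w = (case_option (b + c - d) (x + y - w) :: 'a option \<Rightarrow> int)"
  by (auto simp: fun_eq_iff split: option.split)

lemma option_vec: "z = case_option (z None) (z \<circ> Some)"
  by (auto simp: fun_eq_iff split: option.split)

lemma lift_vec_int_vecs:
  "x \<in> int_vecs N \<Longrightarrow> lift_vec N x \<in> int_vecs (insert None (Some ` N))"
  by (auto simp: lift_vec_def int_vecs_def split: option.splits)

lemma lift_vec_Some [simp]: "lift_vec N x \<circ> Some = x"
  by (auto simp: lift_vec_def)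

lemma exch_lift:
  assumes "exch D f x y w" "pcoord N w = pcoord N x \<or> pcoord N w = pcoord N y"
  shows "exch (lift_vec N ` D) (\<lambda>z. f (z \<circ> Some)) (lift_vec N x) (lift_vec N y) (lift_vec N w)"
proof -
  have "lift_vec N x + lift_vec N y - lift_vec N w = lift_vec N (x + y - w)"
    unfolding lift_vec_def compl_option using pcoord_compl[OF assms(2)] by simp
  then show ?thesis
    using assms(1) unfolding exch_def by simp
qed

text \<open>
  The parity lift of a jump M\<open>\<natural>\<close>-convex function is jump M-convex. One-sidedness of the lifted domain
  follows by induction on the distance: two vectors at odd distance admit a single step from the first towards the
  second, which also gives the second step for vectors at even distance.
  Local exchange is obtained from the pivot coordinate \<open>None\<close>: if a violating pair of equal parity has distance 4, the
  first step alone has to suffice in (JM\<open>\<natural>\<close>-EXC), and this changes the parity coordinate.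
\<close>

theorem jump_M_lift:
  assumes fN: "finite N" and fD: "finite D" and DN: "D \<subseteq> int_vecs N" and jm: "jump_Mnat D f"
  shows "jump_M (lift_vec N ` D) (\<lambda>z. f (z \<circ> Some))"
proof -
  have inN: "z \<in> int_vecs N" if "z \<in> D" for z using that DN by blast
  have adj: "adjacent x u \<longleftrightarrow> l1 N x u = 1" if "x \<in> D" "y \<in> D" "between x u y" for x y u
    using l1_adjacent[OF fN] int_vecs_between that inN by blast
  have adj2: "u \<in> int_vecs N" "l1 N x u = 1" "1 + l1 N u y = l1 N x y"
    if "x \<in> D" "y \<in> D" "between x u y" "adjacent x u" for x y u
    using adj[OF that(1-3)] that(4) l1_between[OF that(3), of N] int_vecs_between[OF that(3)] inN that(1,2) by auto
  have two: "l1 N x w = 2" "between x w y"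
    if "x \<in> D" "y \<in> D" "between x u y" "adjacent x u" "between u w y" "adjacent u w" for x y u w
  proof -
    have b: "between x w y" "between x u w" using between_trans that by blast+
    have "w \<in> int_vecs N" using int_vecs_between b(1) inN that by blast
    then have "l1 N u w = 1" using l1_adjacent[OF fN adj2(1)[OF that(1-4)]] that(6) by blast
    then show "l1 N x w = 2" "between x w y"
      using l1_between[OF b(2), of N] adj2(2)[OF that(1-4)] b by auto
  qed
  have odd_step: "\<exists>w\<in>D. adjacent x w \<and> between x w y"
    if "x \<in> D" "y \<in> D" "odd (l1 N x y)" for x y
    using that
  proof (induction "l1 N x y" arbitrary: y rule: less_induct)
    case less
    then have "x \<noteq> y" by auto
    then obtain u where u: "adjacent x u" "between x u y" by (rule adjacent_exists)
    consider "exch D f x y u" | w where "adjacent u w" "between u w y" "exch D f x y w"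
      using jm less.prems u unfolding jump_Mnat_def by blast
    then show ?case
    proof cases
      case 1
      then show ?thesis using u unfolding exch_def by blast
    next
      case 2
      have w: "l1 N x w = 2" "between x w y" using two[OF less.prems(1,2) u(2,1) 2(2,1)] .
      let ?v = "x + y - w"
      have v: "?v \<in> D" using 2(3) unfolding exch_def by blast
      have xv: "between x ?v y" using between_compl[OF w(2)] .
      have "2 + l1 N x ?v = l1 N x y" using l1_between[OF w(2), of N] w(1) by (simp add: l1_compl)
      then have "l1 N x ?v < l1 N x y" "odd (l1 N x ?v)"
        using less.prems(3) by (simp, metis even_add even_numeral)
      then obtain w' where "w' \<in> D" "adjacent x w'" "between x w' ?v"
        using less.hyps[OF _ less.prems(1) v] by blast
      then show ?thesis using between_trans'(1)[OF xv] by blast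
    qed
  qed
  have even_step: "\<exists>w\<in>D. adjacent u w \<and> between u w y"
    if "x \<in> D" "y \<in> D" "even (l1 N x y)" "adjacent x u" "between x u y" for x y u
  proof -
    note prems = that
    consider "exch D f x y u" | w where "adjacent u w" "between u w y" "exch D f x y w"
      using jm prems unfolding jump_Mnat_def by blast
    then show ?thesis
    proof cases
      case 1
      then have "u \<in> D" unfolding exch_def by blast
      moreover have "odd (l1 N u y)" using adj2(3)[OF prems(1,2,5,4)] prems(3) by (metis even_add odd_one)
      ultimately show ?thesis using odd_step prems(2) by blast
    next
      case 2
      then show ?thesis unfolding exch_def by blast
    qed
  qed
  let ?D = "lift_vec N ` D" and ?f = "\<lambda>z. f (z \<circ> Some)" and ?N = "insert None (Some ` N)"
  let ?p = "pcoord N"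
  have fN': "finite ?N" using fN by simp
  have DN': "?D \<subseteq> int_vecs ?N" using lift_vec_int_vecs DN by blast
  have one: "one_sided ?D"
    unfolding one_sided_def
  proof (intro ballI allI impI)
    fix x' y' u' assume "x' \<in> ?D" "y' \<in> ?D" and u': "adjacent x' u' \<and> between x' u' y'"
    then obtain x y where xy: "x \<in> D" "y \<in> D" "x' = lift_vec N x" "y' = lift_vec N y" by blast
    define b u where "b = u' None" and "u = u' \<circ> Some"
    have ub: "u' = case_option b u" unfolding b_def u_def by (rule option_vec)
    have a: "\<bar>b - ?p x\<bar> = 1 \<and> u = x \<or> b = ?p x \<and> adjacent x u"
      and bt: "between x u y" and bp: "?p x \<le> b \<and> b \<le> ?p y \<or> ?p y \<le> b \<and> b \<le> ?p x"
      using u' unfolding ub xy(3,4) lift_vec_def adjacent_option between_option by auto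
    consider "b \<noteq> ?p x" "u = x" | "b = ?p x" "adjacent x u" using a by fastforce
    then show "\<exists>w\<in>?D. adjacent u' w \<and> between u' w y'"
    proof cases
      case 1
      then have bp': "b = ?p y" "?p x \<noteq> ?p y" using bp pcoord_cases[of N x] pcoord_cases[of N y] by auto
      then have "odd (l1 N x y)" using pcoord_eq_iff by blast
      then obtain w where w: "w \<in> D" "adjacent x w" "between x w y" using odd_step xy by blast
      have "?p w \<noteq> ?p x" using adj2(2)[OF xy(1,2) w(3,2)] pcoord_eq_iff[of N x w] by auto
      then have "?p w = b" using bp' pcoord_cases[of N x] pcoord_cases[of N y] pcoord_cases[of N w] by auto
      then have "adjacent u' (lift_vec N w)" "between u' (lift_vec N w) y'"
        using w 1 bp' unfolding ub xy(4) lift_vec_def adjacent_option between_option by auto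
      then show ?thesis using w(1) by blast
    next
      case 2
      consider w where "w \<in> D" "adjacent u w" "between u w y" | "u \<in> D" "odd (l1 N x y)"
        using even_step[OF xy(1,2) _ 2(2) bt] jm xy(1,2) 2(2) bt unfolding jump_Mnat_def exch_def by blast
      then show ?thesis
      proof cases
        case (1 w)
        have "?p w = b"
          using two(1)[OF xy(1,2) bt 2(2) 1(3,2)] pcoord_eq_iff[of N x w] 2 by auto
        then have "adjacent u' (lift_vec N w)" "between u' (lift_vec N w) y'"
          using 1 2 bp unfolding ub xy(4) lift_vec_def adjacent_option between_option by auto
        then show ?thesis using 1(1) by blast
      next
        case 2
        note 22 = \<open>b = ?p x\<close> \<open>adjacent x u\<close>
        have "?p u \<noteq> ?p x" using adj2(2)[OF xy(1,2) bt 22(2)] pcoord_eq_iff[of N x u] by auto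
        moreover have "?p x \<noteq> ?p y" using 2(2) pcoord_eq_iff[of N x y] by auto
        ultimately have "?p u = ?p y" "\<bar>?p u - b\<bar> = 1"
          using 22 pcoord_cases[of N x] pcoord_cases[of N y] pcoord_cases[of N u] by auto
        then have "adjacent u' (lift_vec N u)" "between u' (lift_vec N u) y'"
          using bp unfolding ub xy(4) lift_vec_def adjacent_option between_option by (auto simp: linear)
        then show ?thesis using 2(1) by blast
      qed
    qed
  qed
  have mid: "midpoint ?N ?D ?f"
  proof (rule pivot_midpoint[OF fN' DN', of None])
    show "coord_exch ?N None ?D ?f"
      unfolding coord_exch_def
    proof (intro ballI allI impI, elim conjE)
      fix x' y' v' assume "x' \<in> ?D" "y' \<in> ?D" and l: "l1 ?N x' y' = 4"
        and v': "adjacent x' v'" "between x' v' y'" "v' None \<noteq> x' None"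
      then obtain x y where xy: "x \<in> D" "y \<in> D" "x' = lift_vec N x" "y' = lift_vec N y" by blast
      define b u where "b = v' None" and "u = v' \<circ> Some"
      have ub: "v' = case_option b u" unfolding b_def u_def by (rule option_vec)
      have ux: "u = x" and b: "b = ?p y" "?p x \<noteq> ?p y"
        using v' pcoord_cases[of N x] pcoord_cases[of N y]
        unfolding ub xy(3,4) lift_vec_def adjacent_option between_option by auto
      have "nat \<bar>?p x - ?p y\<bar> = 1" using b(2) pcoord_cases[of N x] pcoord_cases[of N y] by auto
      then have l3: "l1 N x y = 3" using l unfolding xy(3,4) lift_vec_def l1_option[OF fN] by simp
      then have "x \<noteq> y" by auto
      then obtain t where t: "adjacent x t" "between x t y" by (rule adjacent_exists)
      have "\<exists>w. adjacent x w \<and> between x w y \<and> exch D f x y w"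
      proof -
        consider "exch D f x y t" | w where "adjacent t w" "between t w y" "exch D f x y w"
          using jm xy t unfolding jump_Mnat_def by blast
        then show ?thesis
        proof cases
          case 1
          then show ?thesis using t by blast
        next
          case 2
          have w: "l1 N x w = 2" "between x w y" using two[OF xy(1,2) t(2,1) 2(2,1)] .
          have "l1 N x w + l1 N w y = l1 N x y" using l1_between[OF w(2)] .
          then have "l1 N x (x + y - w) = 1" using w(1) l3 by (simp add: l1_compl)
          moreover have bc: "between x (x + y - w) y" using between_compl[OF w(2)] .
          ultimately show ?thesis using 2(3) exch_compl adj[OF xy(1,2) bc] by blast
        qed
      qed
      then obtain w where w: "adjacent x w" "between x w y" "exch D f x y w" by blast
      have "?p w \<noteq> ?p x" using adj2(2)[OF xy(1,2) w(2,1)] pcoord_eq_iff[of N x w] by auto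
      then have "?p w = ?p y"
        using b pcoord_cases[of N x] pcoord_cases[of N y] pcoord_cases[of N w] by auto
      then show "\<exists>w. adjacent v' w \<and> between v' w y' \<and> exch ?D ?f x' y' w"
        using w exch_lift[OF w(3), of N] unfolding ub ux b xy(3,4)
        by (intro exI[of _ "lift_vec N w"]) (auto simp: lift_vec_def adjacent_option between_option)
    qed
  next
    fix x' y' assume "x' \<in> ?D" "y' \<in> ?D" and l: "l1 ?N x' y' = 4" and eq: "x' None = y' None"
      and no: "\<not> (\<exists>w. l1 ?N x' w = 2 \<and> between x' w y' \<and> exch ?D ?f x' y' w)"
    then obtain x y where xy: "x \<in> D" "y \<in> D" "x' = lift_vec N x" "y' = lift_vec N y" by blast
    have p: "?p x = ?p y" using eq xy by (simp add: lift_vec_def)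
    then have l4: "l1 N x y = 4" using l unfolding xy(3,4) lift_vec_def l1_option[OF fN] by simp
    then have "x \<noteq> y" by auto
    then obtain t where t: "adjacent x t" "between x t y" by (rule adjacent_exists)
    consider "exch D f x y t" | w where "adjacent t w" "between t w y" "exch D f x y w"
      using jm xy t unfolding jump_Mnat_def by blast
    then show "\<exists>v u. adjacent x' v \<and> between x' v y' \<and> u \<in> ?D \<and> adjacent v u \<and> u None \<noteq> v None"
    proof cases
      case 1
      have "?p t \<noteq> ?p x" using adj2(2)[OF xy(1,2) t(2,1)] pcoord_eq_iff[of N x t] by auto
      then have "\<bar>?p t - ?p x\<bar> = 1" using pcoord_cases[of N x] pcoord_cases[of N t] by auto
      then show ?thesis
        using 1 t p unfolding xy(3,4) exch_def
        by (intro exI[of _ "case_option (?p x) t"] exI[of _ "lift_vec N t"])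
          (auto simp: lift_vec_def adjacent_option between_option)
    next
      case 2
      have w: "l1 N x w = 2" "between x w y" using two[OF xy(1,2) t(2,1) 2(2,1)] .
      then have "?p w = ?p x" using pcoord_eq_iff[of N x w] by auto
      then have "l1 ?N x' (lift_vec N w) = 2" "between x' (lift_vec N w) y'"
        "exch ?D ?f x' y' (lift_vec N w)"
        using w p exch_lift[OF 2(3), of N] unfolding xy(3,4)
        by (simp_all add: lift_vec_def l1_option[OF fN] between_option)
      then show ?thesis using no by blast
    qed
  qed
  show ?thesis
    using local_to_global[OF fN' _ DN' one mid] fD by simp
qed

section \<open>Merging two coordinates\<close>

text \<open>
  The function \<open>g\<close> on \<open>E\<close> is the image of \<open>f\<close> under the map \<open>A\<close>: its value at \<open>y\<close> is the minimum of \<open>f\<close> over the fibre of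
  \<open>y\<close>. Requiring the minimum to be attained loses nothing, since only finite domains occur.
\<close>

definition is_push ::
  "(('a \<Rightarrow> int) \<Rightarrow> 'b \<Rightarrow> int) \<Rightarrow> ('a \<Rightarrow> int) set \<Rightarrow> (('a \<Rightarrow> int) \<Rightarrow> real) \<Rightarrow>
    ('b \<Rightarrow> int) set \<Rightarrow> (('b \<Rightarrow> int) \<Rightarrow> real) \<Rightarrow> bool" where
  "is_push A D f E g \<longleftrightarrow> E = A ` D \<and> (\<forall>x\<in>D. g (A x) \<le> f x) \<and> (\<forall>y\<in>E. \<exists>x\<in>D. A x = y \<and> f x = g y)"

lemma is_push_attained:
  "is_push A D f E g \<Longrightarrow> y \<in> E \<Longrightarrow> \<exists>x. x \<in> D \<and> A x = y \<and> f x = g y"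
  unfolding is_push_def by blast

lemma exch_push:
  assumes "is_push A D f E g" "\<And>x y w. A (x + y - w) = A x + A y - A w"
    and "exch D f x y w" "f x = g (A x)" "f y = g (A y)"
  shows "exch E g (A x) (A y) (A w)"
proof -
  have w: "w \<in> D" "x + y - w \<in> D" "f w + f (x + y - w) \<le> f x + f y"
    using assms(3) unfolding exch_def by auto
  have "g (A w) \<le> f w" "g (A (x + y - w)) \<le> f (x + y - w)"
    using assms(1) w unfolding is_push_def by auto
  moreover have "A w \<in> E" "A (x + y - w) \<in> E" using assms(1) w unfolding is_push_def by auto
  ultimately show ?thesis
    using w(3) assms(2,4,5) unfolding exch_def by simp
qed

text \<open>
  The elementary aggregation: \<open>x b\<close> is added to \<open>x a\<close>, and the coordinate \<open>b\<close> is vacated.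
\<close>

definition merge :: "'a \<Rightarrow> 'a \<Rightarrow> ('a \<Rightarrow> int) \<Rightarrow> 'a \<Rightarrow> int" where
  "merge a b x = x(a := x a + x b, b := 0)"

lemma merge_add: "a \<noteq> b \<Longrightarrow> merge a b (x + y - w) = merge a b x + merge a b y - merge a b w"
  by (auto simp: merge_def fun_eq_iff)

lemma merge_apply [simp]: "a \<noteq> b \<Longrightarrow> merge a b x a = x a + x b" "merge a b x b = 0"
  "k \<noteq> a \<Longrightarrow> k \<noteq> b \<Longrightarrow> merge a b x k = x k"
  by (auto simp: merge_def)

lemma merge_adjacent:
  assumes "a \<noteq> b" "adjacent u w"
  shows "adjacent (merge a b u) (merge a b w)"
proof -
  obtain i where i: "\<bar>w i - u i\<bar> = 1" "\<And>k. k \<noteq> i \<Longrightarrow> w k = u k"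
    using assms(2) by (rule adjacentE) blast
  define j where "j = (if i = b then a else i)"
  have "\<bar>merge a b w j - merge a b u j\<bar> = 1"
    using i(1) i(2)[of a] i(2)[of b] assms(1) by (auto simp: j_def merge_def)
  moreover have "merge a b w k = merge a b u k" if "k \<noteq> j" for k
    using i(2)[of k] i(2)[of a] i(2)[of b] assms(1) that by (auto simp: j_def merge_def split: if_splits)
  ultimately show ?thesis unfolding adjacent_def by blast
qed

lemma merge_lift_step:
  assumes "a \<noteq> b" "adjacent (merge a b x) v" "between (merge a b x) v (merge a b y)"
  obtains u where "adjacent x u" "between x u y" "merge a b u = v"
proof -
  let ?m = "merge a b"
  obtain i where i: "\<bar>v i - ?m x i\<bar> = 1" "\<And>k. k \<noteq> i \<Longrightarrow> v k = ?m x k"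
    using assms(2) by (rule adjacentE) blast
  have bi: "?m x i \<le> v i \<and> v i \<le> ?m y i \<or> ?m y i \<le> v i \<and> v i \<le> ?m x i"
    using assms(3) unfolding between_def by blast
  then have ib: "i \<noteq> b" using i(1) by auto
  define e where "e = v i - ?m x i"
  have e: "e = 1 \<and> ?m x i < ?m y i \<or> e = -1 \<and> ?m y i < ?m x i"
    using bi i(1) unfolding e_def by linarith
  have "\<exists>c. (c = i \<or> i = a \<and> c = b) \<and> 0 < e * (y c - x c)"
  proof (cases "i = a")
    case True
    have "0 < e * ((y a - x a) + (y b - x b))"
      using e assms(1) True by auto
    then have "0 < e * (y a - x a) \<or> 0 < e * (y b - x b)"
      by (simp only: distrib_left) linarith
    then show ?thesis using True by blast
  next
    case False
    then have "0 < e * (y i - x i)"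
      using e ib by auto
    then show ?thesis by blast
  qed
  then obtain c where c: "c = i \<or> i = a \<and> c = b" "0 < e * (y c - x c)" by blast
  define u where "u = x(c := x c + e)"
  have "adjacent x u"
    unfolding adjacent_def u_def using e by (intro exI[of _ c]) auto
  moreover have "between x u y"
    unfolding between_def u_def using e c(2) by auto
  moreover have "?m u = v"
  proof
    fix k
    show "?m u k = v k"
      using i(2)[of k] c(1) ib assms(1) by (cases "k = i") (auto simp: u_def e_def merge_def)
  qed
  ultimately show ?thesis by (rule that)
qed

text \<open>
  A unit step moves either towards \<open>y\<close> or away from it.
\<close>

lemma adjacent_between_cases:
  assumes "adjacent v z"
  shows "between v z y \<or> between z v y"
proof -
  obtain i where i: "\<bar>z i - v i\<bar> = 1" "\<And>k. k \<noteq> i \<Longrightarrow> z k = v k"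
    using assms by (rule adjacentE) blast
  have *: "v k \<le> z k \<and> z k \<le> y k \<or> y k \<le> z k \<and> z k \<le> v k"
       "z k \<le> v k \<and> v k \<le> y k \<or> y k \<le> v k \<and> v k \<le> z k" if "k \<noteq> i" for k
    using i(2)[OF that] by auto
  have "(v i \<le> z i \<and> z i \<le> y i \<or> y i \<le> z i \<and> z i \<le> v i) \<or>
       (z i \<le> v i \<and> v i \<le> y i \<or> y i \<le> v i \<and> v i \<le> z i)"
    using i(1) by linarith
  then show ?thesis unfolding between_def using * by metis
qed

text \<open>
  The walk behind this lemma keeps the target fixed. Whenever the current vector has an image
  that oversteps \<open>v\<close> in the wrong direction, the step back to \<open>v\<close> is lifted to a step towards the target and completed
  again; the distance to the target decreases each time.
\<close>

lemma one_sided_merge: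
  assumes "finite N" "D \<subseteq> int_vecs N" "one_sided D" "a \<noteq> b"
  shows "one_sided (merge a b ` D)"
  unfolding one_sided_def
proof (intro ballI allI impI)
  let ?m = "merge a b"
  fix y y' v assume "y \<in> ?m ` D" "y' \<in> ?m ` D" and v: "adjacent y v \<and> between y v y'"
  then obtain x x' where x: "x \<in> D" "x' \<in> D" "y = ?m x" "y' = ?m x'" by blast
  have "\<exists>z\<in>?m ` D. adjacent v z \<and> between v z y'" if "w \<in> D" "adjacent v (?m w)" for w
    using that
  proof (induction "l1 N w x'" arbitrary: w rule: less_induct)
    case less
    show ?case
    proof (cases "between v (?m w) y'")
      case True
      then show ?thesis using less.prems by blast
    next
      case False
      then have "between (?m w) v (?m x')" using adjacent_between_cases[OF less.prems(2)] x(4) by blast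
      moreover have "adjacent (?m w) v" using less.prems(2) adjacent_sym by blast
      ultimately obtain u where u: "adjacent w u" "between w u x'" "?m u = v"
        using merge_lift_step[OF assms(4)] by blast
      obtain t where t: "t \<in> D" "adjacent u t" "between u t x'"
        using assms(3) less.prems(1) x(2) u unfolding one_sided_def by blast
      have b: "between w t x'" "between w u t" using between_trans[OF u(2) t(3)] by auto
      have "u \<in> int_vecs N" using int_vecs_between[OF u(2)] assms(2) less.prems(1) x(2) by blast
      then have "l1 N w u = 1"
        using l1_adjacent[OF assms(1), of w u] u(1) assms(2) less.prems(1) by blast
      then have "l1 N t x' < l1 N w x'"
        using l1_between[OF b(1), of N] l1_between[OF b(2), of N] by simp
      then show ?thesis
        using less.hyps t(1) merge_adjacent[OF assms(4) t(2)] u(3) by blast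
    qed
  qed
  then show "\<exists>w\<in>?m ` D. adjacent v w \<and> between v w y'"
    using x v adjacent_sym by blast
qed

text \<open>
  The combinatorial core of exchange in a merged coordinate. Among the pairs of fixed sum obtained from a given pair by
  changing the two coordinates to be merged only, \<open>S \<alpha> \<beta>\<close> says that the pair whose differences in these two coordinates
  are \<open>\<alpha>\<close> and \<open>\<beta>\<close> does not increase the value sum, and \<open>G\<close> is the desired exchange. The original
  pair has \<open>\<alpha> + \<beta> = d\<close>. A unit step in a coordinate changes its difference by 2, and hence a completed exchange
  inside the plane either returns to total difference \<open>d\<close> or leads to \<open>d - 4\<close>, which is acceptable unless \<open>d = 1\<close>.
  Stepping from total \<open>d\<close> upwards and from total \<open>d - 4\<close> downwards, with the coordinate chosen suitably,
  either yields \<open>G\<close>, or decreases \<open>\<bar>\<alpha>\<bar> + \<bar>\<beta>\<bar>\<close>, or preserves this sum while passing from total \<open>d\<close> to total \<open>d - 4\<close>.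
\<close>

lemma plane_walk:
  fixes S :: "int \<Rightarrow> int \<Rightarrow> bool" and d :: int
  assumes d: "d \<ge> 1"
    and stepL: "\<And>\<alpha> \<beta> e. S \<alpha> \<beta> \<Longrightarrow> \<bar>e\<bar> = 1 \<Longrightarrow> \<alpha> + \<beta> = d - 2 + 2 * e \<Longrightarrow> 0 < e * \<alpha> \<Longrightarrow>
      G \<or> (2 \<le> e * \<alpha> \<and> S (\<alpha> - 4 * e) \<beta>) \<or> (0 < \<beta> \<and> S (\<alpha> - 2 * e) (\<beta> - 2)) \<or> (\<beta> < 0 \<and> S (\<alpha> - 2 * e) (\<beta> + 2))"
    and stepR: "\<And>\<alpha> \<beta> e. S \<alpha> \<beta> \<Longrightarrow> \<bar>e\<bar> = 1 \<Longrightarrow> \<alpha> + \<beta> = d - 2 + 2 * e \<Longrightarrow> 0 < e * \<beta> \<Longrightarrow>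
      G \<or> (2 \<le> e * \<beta> \<and> S \<alpha> (\<beta> - 4 * e)) \<or> (0 < \<alpha> \<and> S (\<alpha> - 2) (\<beta> - 2 * e)) \<or> (\<alpha> < 0 \<and> S (\<alpha> + 2) (\<beta> - 2 * e))"
    and top: "\<And>\<alpha> \<beta>. S \<alpha> \<beta> \<Longrightarrow> \<alpha> + \<beta> = d - 4 \<Longrightarrow> 2 \<le> d \<Longrightarrow> G"
    and "S \<alpha> \<beta>" "\<alpha> + \<beta> = d"
  shows G
proof -
  \<comment> \<open>Total \<open>d\<close> has to count more than total \<open>d - 4\<close>, for the steps that preserve the sum.\<close>
  define \<mu> where "\<mu> \<alpha> \<beta> = nat (2 * (\<bar>\<alpha>\<bar> + \<bar>\<beta>\<bar>) + (if \<alpha> + \<beta> = d then 1 else 0))" for \<alpha> \<beta> :: int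
  have G if "S \<alpha> \<beta>" "\<alpha> + \<beta> = d \<or> \<alpha> + \<beta> = d - 4" for \<alpha> \<beta>
    using that
  proof (induction "\<mu> \<alpha> \<beta>" arbitrary: \<alpha> \<beta> rule: less_induct)
    case less
    have IH: G if "S \<alpha>' \<beta>'" "\<alpha>' + \<beta>' = d \<or> \<alpha>' + \<beta>' = d - 4"
      "\<bar>\<alpha>'\<bar> + \<bar>\<beta>'\<bar> < \<bar>\<alpha>\<bar> + \<bar>\<beta>\<bar> \<or> \<bar>\<alpha>'\<bar> + \<bar>\<beta>'\<bar> = \<bar>\<alpha>\<bar> + \<bar>\<beta>\<bar> \<and> \<alpha> + \<beta> = d \<and> \<alpha>' + \<beta>' = d - 4" for \<alpha>' \<beta>'
    proof (rule less.hyps[OF _ that(1,2)])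
      have "2 * (\<bar>\<alpha>'\<bar> + \<bar>\<beta>'\<bar>) + (if \<alpha>' + \<beta>' = d then 1 else 0)
          < 2 * (\<bar>\<alpha>\<bar> + \<bar>\<beta>\<bar>) + (if \<alpha> + \<beta> = d then 1 else 0)"
        using that(3) by (elim disjE conjE) (simp_all split: if_split)
      then show "\<mu> \<alpha>' \<beta>' < \<mu> \<alpha> \<beta>"
        unfolding \<mu>_def by (subst nat_less_eq_zless) auto
    qed
    show G
    proof (cases "\<alpha> + \<beta> = d")
      case sum: True
      show G
      proof (cases "\<alpha> > 0")
        case True
        show G
          using stepL[OF less.prems(1), of 1] sum True
        proof (simp, elim disjE conjE)
          assume "2 \<le> \<alpha>" "S (\<alpha> - 4) \<beta>"
          then show G using top[of "\<alpha> - 4" \<beta>] IH[of "\<alpha> - 4" \<beta>] sum d by linarith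
        next
          assume "0 < \<beta>" "S (\<alpha> - 2) (\<beta> - 2)"
          then show G using top[of "\<alpha> - 2" "\<beta> - 2"] sum True by linarith
        next
          assume "\<beta> < 0" "S (\<alpha> - 2) (\<beta> + 2)"
          then show G using IH[of "\<alpha> - 2" "\<beta> + 2"] sum d by linarith
        qed
      next
        case False
        then have pos: "\<beta> > 0" using sum d by simp
        show G
          using stepR[OF less.prems(1), of 1] sum pos
        proof (simp, elim disjE conjE)
          assume "2 \<le> \<beta>" "S \<alpha> (\<beta> - 4)"
          then show G using top[of \<alpha> "\<beta> - 4"] IH[of \<alpha> "\<beta> - 4"] sum d False by linarith
        next
          assume "0 < \<alpha>"
          then show G using False by simp
        next
          assume "\<alpha> < 0" "S (\<alpha> + 2) (\<beta> - 2)"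
          then show G using IH[of "\<alpha> + 2" "\<beta> - 2"] sum d by linarith
        qed
      qed
    next
      case False
      then have sum: "\<alpha> + \<beta> = d - 4" using less.prems(2) by simp
      show G
      proof (cases "2 \<le> d")
        case True
        then show G using top less.prems(1) sum by blast
      next
        case False
        then have d1: "d = 1" using d by simp
        consider "\<alpha> \<ge> 0 \<or> \<alpha> = -2" | "\<beta> \<ge> 0 \<or> \<beta> = -2" using sum d1 by linarith
        then show G
        proof cases
          case 1
          then have neg: "\<beta> < 0" using sum d1 by linarith
          show G
            using stepR[OF less.prems(1), of "-1"] sum d1 neg
          proof (simp, elim disjE conjE)
            assume "2 \<le> - \<beta>" "S \<alpha> (\<beta> + 4)"
            then show G using IH[of \<alpha> "\<beta> + 4"] sum d1 1 by linarith
          next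
            assume "0 < \<alpha>" "S (\<alpha> - 2) (\<beta> + 2)"
            then show G using IH[of "\<alpha> - 2" "\<beta> + 2"] sum d1 by linarith
          next
            assume "\<alpha> < 0" "S (\<alpha> + 2) (\<beta> + 2)"
            then show G using IH[of "\<alpha> + 2" "\<beta> + 2"] sum d1 1 by linarith
          qed
        next
          case 2
          then have neg: "\<alpha> < 0" using sum d1 by linarith
          show G
            using stepL[OF less.prems(1), of "-1"] sum d1 neg
          proof (simp, elim disjE conjE)
            assume "2 \<le> - \<alpha>" "S (\<alpha> + 4) \<beta>"
            then show G using IH[of "\<alpha> + 4" \<beta>] sum d1 2 by linarith
          next
            assume "0 < \<beta>" "S (\<alpha> + 2) (\<beta> - 2)"
            then show G using IH[of "\<alpha> + 2" "\<beta> - 2"] sum d1 by linarith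
          next
            assume "\<beta> < 0" "S (\<alpha> + 2) (\<beta> + 2)"
            then show G using IH[of "\<alpha> + 2" "\<beta> + 2"] sum d1 2 by linarith
          qed
        qed
      qed
    qed
  qed
  then show G using assms(5,6) by blast
qed

lemma unit_step_pos:
  fixes u w z :: int
  assumes "\<bar>w - u\<bar> = 1" "u \<le> w \<and> w \<le> z \<or> z \<le> w \<and> w \<le> u"
  shows "0 < (w - u) * (z - u)"
proof -
  have "w = u + 1 \<and> u < z \<or> w = u - 1 \<and> z < u" using assms by linarith
  then show ?thesis by auto
qed

lemma unit_sign:
  fixes e t :: int
  assumes "\<bar>e\<bar> = 1" "0 < e * t"
  shows "e = 1 \<and> 0 < t \<or> e = -1 \<and> t < 0"
proof -
  have "e = 1 \<or> e = -1" using assms(1) by linarith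
  then show ?thesis using assms(2) by auto
qed

text \<open>
  Exchange holds for every upward first step in the merged coordinate. A walk in the plane of the two original
  coordinates starts from minimising representatives; as soon as a step uses another coordinate, its image is an
  admissible completion of the step.
\<close>

lemma merged_coordinate_exch:
  assumes "a \<noteq> b" "jump_M D f" and push: "is_push (merge a b) D f E g"
    and "y \<in> E" "y' \<in> E" "y a < y' a"
  shows "\<exists>w. adjacent (y(a := y a + 1)) w \<and> between (y(a := y a + 1)) w y' \<and> exch E g y y' w"
proof -
  let ?m = "merge a b"
  define v where "v = y(a := y a + 1)"
  define G where "G \<longleftrightarrow> (\<exists>w. adjacent v w \<and> between v w y' \<and> exch E g y y' w)"
  obtain x x' where x: "x \<in> D" "?m x = y" "f x = g y" and x': "x' \<in> D" "?m x' = y'" "f x' = g y'"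
    using is_push_attained[OF push assms(4)] is_push_attained[OF push assms(5)] by blast
  have pushed: "exch E g y y' (?m w)" if "exch D f x x' w" for w
    using exch_push[OF push merge_add[OF assms(1)] that] x x' by simp
  have level: "y a = x a + x b" "y' a = x' a + x' b" using x(2) x'(2) assms(1) by auto
  \<comment> \<open>The first vector of a candidate pair; the second one is \<open>x + x' - z\<close>.\<close>
  define state where "state z \<longleftrightarrow> (\<forall>k. k \<noteq> a \<and> k \<noteq> b \<longrightarrow> z k = x k) \<and> exch D f x x' z" for z
  have v_eq: "?m u = v" if "\<forall>k. k \<noteq> a \<and> k \<noteq> b \<longrightarrow> u k = x k" "u a + u b = y a + 1" for u
  proof
    fix k
    show "?m u k = v k"
      using that level x(2) assms(1) by (cases "k = a \<or> k = b") (auto simp: v_def merge_def)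
  qed
  \<comment> \<open>A step that brings the image to \<open>v\<close> is completed either outside the two coordinates, which gives
    \<open>G\<close>, or inside, which gives another candidate pair.\<close>
  have step: "G \<or> (\<exists>k w. (k = a \<or> k = b) \<and> state w \<and> \<bar>w k - u k\<bar> = 1 \<and> (\<forall>l. l \<noteq> k \<longrightarrow> w l = u l) \<and>
      0 < (w k - u k) * (x k + x' k - z k - u k))"
    if z: "state z" and c: "c = a \<or> c = b" and e: "\<bar>e\<bar> = 1" "0 < e * (x c + x' c - 2 * z c)"
      "z a + z b + e = y a + 1" and u: "u = z(c := z c + e)" for z c e u
  proof -
    define z' where "z' = x + x' - z"
    have zD: "z \<in> D" "z' \<in> D" "f z + f z' \<le> f x + f x'"
      using z unfolding state_def exch_def z'_def by auto
    have adj: "adjacent z u" unfolding adjacent_def u using e(1) by (intro exI[of _ c]) auto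
    have "z' c - z c = x c + x' c - 2 * z c" by (simp add: z'_def)
    then have "between z u z'"
      unfolding between_def u using e(1,2) by (auto simp: abs_if split: if_splits)
    then obtain w where w: "adjacent u w" "between u w z'" "exch D f z z' w"
      using assms(2) zD adj unfolding jump_M_def by blast
    have zz: "z + z' = x + x'" by (simp add: z'_def)
    have wx: "exch D f x x' w"
      using w(3) zD(3) unfolding exch_def zz by auto
    obtain k where k: "\<bar>w k - u k\<bar> = 1" "\<And>l. l \<noteq> k \<Longrightarrow> w l = u l"
      using w(1) by (rule adjacentE) blast
    have zk: "z' k = x k + x' k - z k" by (simp add: z'_def)
    show ?thesis
    proof (cases "k = a \<or> k = b")
      case True
      have "state w"
        using z wx k(2) True c unfolding state_def u by auto
      moreover have "0 < (w k - u k) * (x k + x' k - z k - u k)"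
        using unit_step_pos[OF k(1) w(2)[unfolded between_def, rule_format, of k]] unfolding zk .
      ultimately show ?thesis using True k by blast
    next
      case False
      have mu: "?m u = v"
        by (rule v_eq) (use z c e(3) assms(1) in \<open>auto simp: state_def u\<close>)
      have "adjacent v (?m w)"
        using merge_adjacent[OF assms(1) w(1)] mu by simp
      moreover have "between v (?m w) y'"
        unfolding between_def
      proof
        fix l
        show "v l \<le> ?m w l \<and> ?m w l \<le> y' l \<or> y' l \<le> ?m w l \<and> ?m w l \<le> v l"
        proof (cases "l = k")
          case True
          then have "v l = u l" "?m w l = w l" "y' l = x' l" "z' l = x' l"
            using False mu x'(2) z by (auto simp: z'_def state_def)
          then show ?thesis using w(2) unfolding between_def by metis
        next
          case l: False
          have "w a = u a" "w b = u b" "w l = u l" using k(2) False l by auto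
          then have "?m w l = v l" unfolding mu[symmetric] merge_def by simp
          then show ?thesis by auto
        qed
      qed
      ultimately show ?thesis using pushed[OF wx] unfolding G_def by blast
    qed
  qed
  define S where "S \<alpha> \<beta> \<longleftrightarrow> (\<exists>z. state z \<and> x a + x' a - 2 * z a = \<alpha> \<and> x b + x' b - 2 * z b = \<beta>)" for \<alpha> \<beta>
  define d where "d = y' a - y a"
  have G
  proof (rule plane_walk[of d S G "x' a - x a" "x' b - x b"])
    show "1 \<le> d" using assms(6) by (simp add: d_def)
    show "S (x' a - x a) (x' b - x b)"
      unfolding S_def state_def exch_def using x(1) x'(1) by (intro exI[of _ x]) auto
    show "x' a - x a + (x' b - x b) = d" by (simp add: d_def level)
  next
    fix \<alpha> \<beta> assume "S \<alpha> \<beta>" and s: "\<alpha> + \<beta> = d - 4" and d2: "2 \<le> d"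
    then obtain z where z: "state z" "x a + x' a - 2 * z a = \<alpha>" "x b + x' b - 2 * z b = \<beta>"
      unfolding S_def by blast
    have lz: "z a + z b = y a + 2" using z(2,3) s by (simp add: d_def level)
    have mz: "?m z k = v k" if "k \<noteq> a" for k
      using that z(1) x(2) assms(1) by (cases "k = b") (auto simp: state_def v_def merge_def)
    have "adjacent v (?m z)"
      unfolding adjacent_def using mz lz assms(1) by (intro exI[of _ a]) (auto simp: v_def)
    moreover have "between v (?m z) y'"
      unfolding between_def
    proof
      fix k
      show "v k \<le> ?m z k \<and> ?m z k \<le> y' k \<or> y' k \<le> ?m z k \<and> ?m z k \<le> v k"
        using mz[of k] lz d2 assms(1) by (cases "k = a") (auto simp: v_def d_def)
    qed
    ultimately show G using pushed z(1) unfolding G_def state_def by blast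
  next
    fix \<alpha> \<beta> e :: int
    assume "S \<alpha> \<beta>" and e: "\<bar>e\<bar> = 1" and s: "\<alpha> + \<beta> = d - 2 + 2 * e" and pos: "0 < e * \<alpha>"
    then obtain z where z: "state z" "x a + x' a - 2 * z a = \<alpha>" "x b + x' b - 2 * z b = \<beta>"
      unfolding S_def by blast
    have lz: "z a + z b + e = y a + 1" using z(2,3) s by (simp add: d_def level)
    define u where "u = z(a := z a + e)"
    from step[OF z(1) _ e _ lz u_def] pos z(2)
    consider G | k w where "k = a \<or> k = b" "state w" "\<bar>w k - u k\<bar> = 1" "\<forall>l. l \<noteq> k \<longrightarrow> w l = u l"
      "0 < (w k - u k) * (x k + x' k - z k - u k)" by auto
    then show "G \<or> (2 \<le> e * \<alpha> \<and> S (\<alpha> - 4 * e) \<beta>) \<or> (0 < \<beta> \<and> S (\<alpha> - 2 * e) (\<beta> - 2)) \<or>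
        (\<beta> < 0 \<and> S (\<alpha> - 2 * e) (\<beta> + 2))"
    proof cases
      case 1
      then show ?thesis by blast
    next
      case (2 k w)
      note sgn = unit_sign[OF e pos] unit_sign[OF 2(3,5)]
      have Sw: "S (x a + x' a - 2 * w a) (x b + x' b - 2 * w b)" unfolding S_def using 2(2) by blast
      show ?thesis
      proof (cases "k = a")
        case True
        have wb: "w b = z b" using 2(4) True assms(1) by (auto simp: u_def)
        have "w a - u a = e \<and> 2 \<le> e * \<alpha>"
          using sgn z(2) unfolding True u_def fun_upd_same by (elim disjE conjE) auto
        then show ?thesis using Sw wb z(2,3) by (auto simp: u_def algebra_simps)
      next
        case False
        then have kb: "k = b" using 2(1) by blast
        have wa: "w a = z a + e" using 2(4) kb assms(1) by (auto simp: u_def)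
        have ub: "u b = z b" using assms(1) by (simp add: u_def)
        have "x b + x' b - 2 * w b = \<beta> - 2 \<and> 0 < \<beta> \<or> x b + x' b - 2 * w b = \<beta> + 2 \<and> \<beta> < 0"
          using sgn(2) z(3) unfolding kb ub by linarith
        moreover have "x a + x' a - 2 * w a = \<alpha> - 2 * e" using wa z(2) by linarith
        ultimately show ?thesis using Sw by metis
      qed
    qed
  next
    fix \<alpha> \<beta> e :: int
    assume "S \<alpha> \<beta>" and e: "\<bar>e\<bar> = 1" and s: "\<alpha> + \<beta> = d - 2 + 2 * e" and pos: "0 < e * \<beta>"
    then obtain z where z: "state z" "x a + x' a - 2 * z a = \<alpha>" "x b + x' b - 2 * z b = \<beta>"
      unfolding S_def by blast
    have lz: "z a + z b + e = y a + 1" using z(2,3) s by (simp add: d_def level)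
    define u where "u = z(b := z b + e)"
    from step[OF z(1) _ e _ lz u_def] pos z(3)
    consider G | k w where "k = a \<or> k = b" "state w" "\<bar>w k - u k\<bar> = 1" "\<forall>l. l \<noteq> k \<longrightarrow> w l = u l"
      "0 < (w k - u k) * (x k + x' k - z k - u k)" by auto
    then show "G \<or> (2 \<le> e * \<beta> \<and> S \<alpha> (\<beta> - 4 * e)) \<or> (0 < \<alpha> \<and> S (\<alpha> - 2) (\<beta> - 2 * e)) \<or>
        (\<alpha> < 0 \<and> S (\<alpha> + 2) (\<beta> - 2 * e))"
    proof cases
      case 1
      then show ?thesis by blast
    next
      case (2 k w)
      note sgn = unit_sign[OF e pos] unit_sign[OF 2(3,5)]
      have Sw: "S (x a + x' a - 2 * w a) (x b + x' b - 2 * w b)" unfolding S_def using 2(2) by blast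
      show ?thesis
      proof (cases "k = b")
        case True
        have wb: "w a = z a" using 2(4) True assms(1) by (auto simp: u_def)
        have "w b - u b = e \<and> 2 \<le> e * \<beta>"
          using sgn z(3) unfolding True u_def fun_upd_same by (elim disjE conjE) auto
        then show ?thesis using Sw wb z(2,3) by (auto simp: u_def algebra_simps)
      next
        case False
        then have kb: "k = a" using 2(1) by blast
        have wa: "w b = z b + e" using 2(4) kb assms(1) by (auto simp: u_def)
        have ub: "u a = z a" using assms(1) by (simp add: u_def)
        have "x a + x' a - 2 * w a = \<alpha> - 2 \<and> 0 < \<alpha> \<or> x a + x' a - 2 * w a = \<alpha> + 2 \<and> \<alpha> < 0"
          using sgn(2) z(2) unfolding kb ub by linarith
        moreover have "x b + x' b - 2 * w b = \<beta> - 2 * e" using wa z(3) by linarith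
        ultimately show ?thesis using Sw by metis
      qed
    qed
  qed
  then show ?thesis unfolding G_def v_def .
qed

text \<open>
  Elementary aggregation preserves jump M-convexity. The pivot is the merged coordinate: when a pair agrees in it, a
  first step in another coordinate can only fail to be completed properly by a step in the merged coordinate.
\<close>

theorem jump_M_merge:
  assumes fN: "finite N" and fD: "finite D" and DN: "D \<subseteq> int_vecs N" and ab: "a \<in> N" "b \<in> N" "a \<noteq> b"
    and jm: "jump_M D f" and push: "is_push (merge a b) D f E g"
  shows "jump_M E g"
proof -
  let ?m = "merge a b"
  have E: "E = ?m ` D" using push unfolding is_push_def by blast
  have mN: "?m x \<in> int_vecs N" if "x \<in> int_vecs N" for x
    using that ab by (auto simp: merge_def int_vecs_def)
  have EN: "E \<subseteq> int_vecs N" using mN DN unfolding E by blast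
  have inE: "z \<in> int_vecs N" if "z \<in> E" for z using that EN by blast
  have "one_sided D" using jm unfolding jump_M_def one_sided_def exch_def by blast
  then have one: "one_sided E" unfolding E using one_sided_merge[OF fN DN] ab by blast
  have mid: "midpoint N E g"
  proof (rule pivot_midpoint[OF fN EN, of a])
    show "coord_exch N a E g"
      unfolding coord_exch_def
    proof (intro ballI allI impI, elim conjE)
      fix y y' v assume y: "y \<in> E" "y' \<in> E" and v: "adjacent y v" "between y v y'" "v a \<noteq> y a"
      obtain i where i: "\<bar>v i - y i\<bar> = 1" "\<And>k. k \<noteq> i \<Longrightarrow> v k = y k"
        using v(1) by (rule adjacentE) blast
      have ia: "i = a" using i(2)[of a] v(3) by blast
      have va: "v a = y a + 1 \<and> y a < y' a \<or> v a = y a - 1 \<and> y' a < y a"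
        using i(1) v(2)[unfolded between_def, rule_format, of a] unfolding ia by linarith
      have veq: "v = y(a := v a)" using i(2) unfolding ia by auto
      show "\<exists>w. adjacent v w \<and> between v w y' \<and> exch E g y y' w"
        using va
      proof (elim disjE conjE)
        assume "v a = y a + 1" "y a < y' a"
        then show ?thesis
          using merged_coordinate_exch[OF ab(3) jm push y] veq by auto
      next
        assume s: "v a = y a - 1" "y' a < y a"
        \<comment> \<open>A downward step from \<open>y\<close> is opposite to an upward step from \<open>y'\<close>.\<close>
        define v' where "v' = y'(a := y' a + 1)"
        obtain w where w: "adjacent v' w" "between v' w y" "exch E g y' y w"
          using merged_coordinate_exch[OF ab(3) jm push y(2,1) s(2)] unfolding v'_def by blast
        define z where "z = y + y' - w"
        have vv: "v k + v' k = y k + y' k" for k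
          using veq s(1) by (cases "k = a") (auto simp: v'_def fun_eq_iff)
        obtain j where j: "\<bar>w j - v' j\<bar> = 1" "\<And>k. k \<noteq> j \<Longrightarrow> w k = v' k"
          using w(1) by (rule adjacentE) blast
        have zv: "z k - v k = v' k - w k" for k using vv[of k] by (simp add: z_def)
        have "adjacent v z"
          unfolding adjacent_def
        proof (intro exI[of _ j] conjI allI impI)
          show "\<bar>z j - v j\<bar> = 1" using zv[of j] j(1) by linarith
          show "z k = v k" if "k \<noteq> j" for k using zv[of k] j(2)[OF that] by linarith
        qed
        moreover have "between v z y'"
          unfolding between_def
        proof
          fix k
          have "z k = y k + y' k - w k" "v k = y k + y' k - v' k" using vv[of k] by (auto simp: z_def)
          then show "v k \<le> z k \<and> z k \<le> y' k \<or> y' k \<le> z k \<and> z k \<le> v k"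
            using w(2)[unfolded between_def, rule_format, of k] by linarith
        qed
        moreover have "exch E g y y' z"
          using w(3) exch_sym exch_compl unfolding z_def by blast
        ultimately show ?thesis by blast
      qed
    qed
  next
    fix y y' assume y: "y \<in> E" "y' \<in> E" "l1 N y y' = 4" "y a = y' a"
      and no: "\<not> (\<exists>w. l1 N y w = 2 \<and> between y w y' \<and> exch E g y y' w)"
    obtain x x' where x: "x \<in> D" "?m x = y" "f x = g y" and x': "x' \<in> D" "?m x' = y'" "f x' = g y'"
      using is_push_attained[OF push y(1)] is_push_attained[OF push y(2)] by blast
    have "y \<noteq> y'" using y(3) by auto
    then obtain v where v: "adjacent y v" "between y v y'" by (rule adjacent_exists)
    then obtain u where u: "adjacent x u" "between x u x'" "?m u = v"
      using merge_lift_step[OF ab(3), of x v x'] x(2) x'(2) by blast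
    obtain w where w: "adjacent u w" "between u w x'" "exch D f x x' w"
      using jm x(1) x'(1) u unfolding jump_M_def by blast
    let ?z = "?m w"
    have ex: "exch E g y y' ?z"
      using exch_push[OF push merge_add[OF ab(3)] w(3)] x x' by simp
    then have zE: "?z \<in> E" unfolding exch_def by blast
    have adj: "adjacent v ?z" using merge_adjacent[OF ab(3) w(1)] u(3) by simp
    have "\<not> between v ?z y'"
    proof
      assume b: "between v ?z y'"
      have b': "between y ?z y'" "between y v ?z" using between_trans[OF v(2) b] by auto
      have vN: "v \<in> int_vecs N" using int_vecs_between[OF v(2)] inE y by blast
      have "l1 N y v = 1" "l1 N v ?z = 1"
        using l1_adjacent[OF fN] v(1) adj inE y(1) zE vN by blast+
      then have "l1 N y ?z = 2" using l1_between[OF b'(2), of N] by simp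
      then show False using no b'(1) ex by blast
    qed
    moreover have "between v ?z y'" if "?z a = v a"
      unfolding between_def
    proof
      fix k
      show "v k \<le> ?z k \<and> ?z k \<le> y' k \<or> y' k \<le> ?z k \<and> ?z k \<le> v k"
      proof (cases "k = a \<or> k = b")
        case True
        then have "?z k = v k" using that u(3) by auto
        then show ?thesis by auto
      next
        case False
        then have "?z k = w k" "v k = u k" "y' k = x' k" using u(3) x'(2) by auto
        then show ?thesis using w(2) unfolding between_def by metis
      qed
    qed
    ultimately show "\<exists>v u. adjacent y v \<and> between y v y' \<and> u \<in> E \<and> adjacent v u \<and> u a \<noteq> v a"
      using v zE adj by blast
  qed
  show ?thesis
    using local_to_global[OF fN _ EN one mid] fD E by simp
qed

section \<open>Aggregation\<close>

text \<open>
  Aggregation along a map \<open>\<phi>\<close> of indices: coordinate \<open>j\<close> of the image is the sum over the fibre of \<open>j\<close>.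
\<close>

definition agg :: "'a set \<Rightarrow> ('a \<Rightarrow> 'b) \<Rightarrow> ('a \<Rightarrow> int) \<Rightarrow> 'b \<Rightarrow> int" where
  "agg N \<phi> x = (\<lambda>j. \<Sum>i\<in>{i \<in> N. \<phi> i = j}. x i)"

lemma agg_add: "agg N \<phi> (x + y - w) = agg N \<phi> x + agg N \<phi> y - agg N \<phi> w"
  by (auto simp: agg_def fun_eq_iff sum.distrib sum_subtractf)

lemma is_push_exists:
  assumes "finite D"
  obtains g where "is_push A D f (A ` D) g"
proof
  show "is_push A D f (A ` D) (\<lambda>y. Min (f ` {x \<in> D. A x = y}))"
    unfolding is_push_def
  proof (intro conjI ballI refl)
    show "Min (f ` {x' \<in> D. A x' = A x}) \<le> f x" if "x \<in> D" for x
      using assms that by (intro Min_le) auto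
    show "\<exists>x\<in>D. A x = y \<and> f x = Min (f ` {x' \<in> D. A x' = y})" if "y \<in> A ` D" for y
    proof -
      have "Min (f ` {x' \<in> D. A x' = y}) \<in> f ` {x' \<in> D. A x' = y}"
        using assms that by (intro Min_in) auto
      then show ?thesis by auto
    qed
  qed
qed

text \<open>
  Aggregation along an injective map is a renaming of coordinates.
\<close>

lemma jump_M_relabel:
  assumes inj: "inj_on \<phi> N" and DN: "D \<subseteq> int_vecs N" and jm: "jump_M D f"
    and push: "is_push (agg N \<phi>) D f E g"
  shows "jump_M E g"
  unfolding jump_M_def
proof (intro ballI allI impI, elim conjE)
  fix y y' v assume y: "y \<in> E" "y' \<in> E" and v: "adjacent y v" "between y v y'"
  have ag: "agg N \<phi> z (\<phi> i) = z i" if "i \<in> N" for z i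
  proof -
    have "{k \<in> N. \<phi> k = \<phi> i} = {i}" using inj that by (auto dest: inj_onD)
    then show ?thesis by (simp add: agg_def)
  qed
  have ag0: "agg N \<phi> z j = 0" if "j \<notin> \<phi> ` N" for z j
    using that by (auto simp: agg_def intro: sum.neutral)
  have eqI: "z = z'" if "\<And>i. i \<in> N \<Longrightarrow> z (\<phi> i) = z' (\<phi> i)" "\<And>j. j \<notin> \<phi> ` N \<Longrightarrow> z j = z' j" for z z' :: "'b \<Rightarrow> int"
    using that by (intro ext) (metis imageE)
  obtain x x' where x: "x \<in> D" "agg N \<phi> x = y" "f x = g y" and x': "x' \<in> D" "agg N \<phi> x' = y'" "f x' = g y'"
    using is_push_attained[OF push y(1)] is_push_attained[OF push y(2)] by blast
  obtain j where j: "\<bar>v j - y j\<bar> = 1" "\<And>k. k \<noteq> j \<Longrightarrow> v k = y k"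
    using v(1) by (rule adjacentE) blast
  have "j \<in> \<phi> ` N"
  proof (rule ccontr)
    assume "j \<notin> \<phi> ` N"
    then have "y j = 0" "y' j = 0" using ag0 x(2) x'(2) by blast+
    then show False using j(1) v(2)[unfolded between_def, rule_format, of j] by auto
  qed
  then obtain i where i: "i \<in> N" "j = \<phi> i" by blast
  define u where "u = x(i := v j)"
  have yx: "y (\<phi> k) = x k" "y' (\<phi> k) = x' k" if "k \<in> N" for k
    using ag[OF that] x(2) x'(2) by auto
  have ux: "adjacent x u"
    unfolding adjacent_def u_def using j(1) yx[OF i(1)] i(2) by (intro exI[of _ i]) auto
  have "between x u x'"
    unfolding between_def u_def
    using v(2)[unfolded between_def, rule_format, of j] yx[OF i(1)] i(2) by (auto simp: linear)
  then obtain w where w: "adjacent u w" "between u w x'" "exch D f x x' w"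
    using jm x(1) x'(1) ux unfolding jump_M_def by blast
  have uv: "agg N \<phi> u = v"
  proof (rule eqI)
    show "agg N \<phi> u (\<phi> k) = v (\<phi> k)" if "k \<in> N" for k
    proof (cases "k = i")
      case True
      then show ?thesis using ag[OF that, of u] i(2) by (simp add: u_def)
    next
      case False
      then have "\<phi> k \<noteq> j" using inj_onD[OF inj _ that i(1)] i(2) by blast
      then show ?thesis using ag[OF that, of u] yx(1)[OF that] j(2)[of "\<phi> k"] False by (simp add: u_def)
    qed
    show "agg N \<phi> u l = v l" if "l \<notin> \<phi> ` N" for l
    proof -
      have "l \<noteq> j" using that i by blast
      then show ?thesis using ag0[OF that, of u] ag0[OF that, of x] j(2)[of l] x(2) by simp
    qed
  qed
  obtain k where k: "\<bar>w k - u k\<bar> = 1" "\<And>l. l \<noteq> k \<Longrightarrow> w l = u l"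
    using w(1) by (rule adjacentE) blast
  have "u k = 0 \<and> w k = 0" if "k \<notin> N"
  proof -
    have "x k = 0" "x' k = 0" "w k = 0"
      using that DN x(1) x'(1) w(3) by (auto simp: int_vecs_def exch_def)
    then show ?thesis using that i(1) by (auto simp: u_def)
  qed
  then have kN: "k \<in> N" using k(1) by (cases "k \<in> N") auto
  have "adjacent v (agg N \<phi> w)"
    unfolding adjacent_def
  proof (intro exI[of _ "\<phi> k"] conjI allI impI)
    show "\<bar>agg N \<phi> w (\<phi> k) - v (\<phi> k)\<bar> = 1"
      using k(1) ag[OF kN] unfolding uv[symmetric] by simp
    show "agg N \<phi> w l = v l" if "l \<noteq> \<phi> k" for l
    proof (cases "l \<in> \<phi> ` N")
      case True
      then obtain h where h: "h \<in> N" "l = \<phi> h" by blast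
      then have "h \<noteq> k" using that by blast
      then show ?thesis using h k(2)[of h] ag[OF h(1)] unfolding uv[symmetric] by simp
    next
      case False
      then show ?thesis using ag0 unfolding uv[symmetric] by simp
    qed
  qed
  moreover have "between v (agg N \<phi> w) y'"
    unfolding between_def
  proof
    fix l
    show "v l \<le> agg N \<phi> w l \<and> agg N \<phi> w l \<le> y' l \<or> y' l \<le> agg N \<phi> w l \<and> agg N \<phi> w l \<le> v l"
    proof (cases "l \<in> \<phi> ` N")
      case True
      then obtain h where "h \<in> N" "l = \<phi> h" by blast
      then show ?thesis
        using w(2)[unfolded between_def, rule_format, of h] ag yx(2) unfolding uv[symmetric] by simp
    next
      case False
      then show ?thesis using ag0 x'(2) unfolding uv[symmetric] by auto
    qed
  qed
  moreover have "exch E g y y' (agg N \<phi> w)"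
    using exch_push[OF push agg_add w(3)] x x' by simp
  ultimately show "\<exists>w. adjacent v w \<and> between v w y' \<and> exch E g y y' w" by blast
qed

lemma agg_merge:
  assumes "finite N" "a \<in> N" "b \<in> N" "a \<noteq> b" "\<phi> a = \<phi> b"
  shows "agg (N - {b}) \<phi> (merge a b x) = agg N \<phi> x"
proof
  fix j
  show "agg (N - {b}) \<phi> (merge a b x) j = agg N \<phi> x j"
  proof (cases "\<phi> a = j")
    case True
    define R where "R = {i \<in> N. \<phi> i = j} - {a, b}"
    have R: "finite R" "a \<notin> R" "b \<notin> R" using assms(1) by (auto simp: R_def)
    have e: "{i \<in> N - {b}. \<phi> i = j} = insert a R" "{i \<in> N. \<phi> i = j} = insert a (insert b R)"
      using assms True by (auto simp: R_def)
    have "agg (N - {b}) \<phi> (merge a b x) j = merge a b x a + (\<Sum>i\<in>R. merge a b x i)"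
      unfolding agg_def e(1) using R by simp
    also have "(\<Sum>i\<in>R. merge a b x i) = (\<Sum>i\<in>R. x i)"
      using R by (intro sum.cong) (auto simp: merge_def)
    also have "merge a b x a + (\<Sum>i\<in>R. x i) = agg N \<phi> x j"
      unfolding agg_def e(2) using R assms(4) by simp
    finally show ?thesis .
  next
    case False
    then have e: "{i \<in> N - {b}. \<phi> i = j} = {i \<in> N. \<phi> i = j}" using assms(5) by auto
    have "merge a b x i = x i" if "\<phi> i = j" for i
      using that False assms(5) by (metis merge_apply(3) assms(4))
    then show ?thesis unfolding agg_def e by (intro sum.cong) auto
  qed
qed

text \<open>
  Any aggregation is a sequence of elementary ones followed by a renaming of coordinates.
\<close>

theorem jump_M_agg:
  assumes "finite N" "finite D" "D \<subseteq> int_vecs N" "jump_M D f" "is_push (agg N \<phi>) D f E g"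
  shows "jump_M E g"
  using assms
proof (induction "card N" arbitrary: N D f rule: less_induct)
  case less
  show ?case
  proof (cases "inj_on \<phi> N")
    case True
    then show ?thesis using jump_M_relabel less.prems by blast
  next
    case False
    then obtain a b where ab: "a \<in> N" "b \<in> N" "a \<noteq> b" "\<phi> a = \<phi> b" unfolding inj_on_def by blast
    let ?m = "merge a b" and ?D = "merge a b ` D" and ?A = "agg (N - {b}) \<phi>"
    have eq: "?A (?m x) = agg N \<phi> x" for x using agg_merge less.prems(1) ab by metis
    obtain h where h: "is_push ?m D f ?D h" using is_push_exists less.prems(2) by blast
    have jm: "jump_M ?D h" using jump_M_merge[OF less.prems(1-3) ab(1-3) less.prems(4) h] .
    have DN: "?D \<subseteq> int_vecs (N - {b})"
      using less.prems(3) ab by (auto simp: merge_def int_vecs_def)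
    have "is_push ?A ?D h E g"
      unfolding is_push_def
    proof (intro conjI ballI)
      show "E = ?A ` ?D"
        using less.prems(5) unfolding is_push_def image_image eq by blast
    next
      fix y assume "y \<in> ?D"
      then obtain x where "x \<in> D" "?m x = y" "f x = h y" using is_push_attained[OF h] by blast
      then show "g (?A y) \<le> h y" using less.prems(5) eq[of x] unfolding is_push_def by metis
    next
      fix z assume "z \<in> E"
      then obtain x where x: "x \<in> D" "agg N \<phi> x = z" "f x = g z"
        using is_push_attained[OF less.prems(5)] by blast
      have "h (?m x) \<le> g z" using h x unfolding is_push_def by metis
      moreover obtain x' where x': "x' \<in> D" "?m x' = ?m x" "f x' = h (?m x)"
        using is_push_attained[OF h, of "?m x"] x(1) by blast
      moreover have "agg N \<phi> x' = z" using eq[of x] eq[of x'] x'(2) x(2) by simp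
      then have "g z \<le> f x'" using less.prems(5) x'(1) unfolding is_push_def by metis
      ultimately show "\<exists>y\<in>?D. ?A y = z \<and> h y = g z"
        using x eq[of x] by (intro bexI[of _ "?m x"]) auto
    qed
    moreover have "card (N - {b}) < card N" using less.prems(1) ab(2) by (rule card_Diff1_less)
    ultimately show ?thesis
      using less.hyps[of "N - {b}" ?D h] less.prems(1,2) DN jm by blast
  qed
qed

lemma agg_option:
  assumes "finite N"
  shows "agg (insert None (Some ` N)) (map_option \<phi>) (case_option c x) = case_option c (agg N \<phi> x)"
proof
  fix j
  show "agg (insert None (Some ` N)) (map_option \<phi>) (case_option c x) j = case_option c (agg N \<phi> x) j"
  proof (cases j)
    case None
    then have "{i \<in> insert None (Some ` N). map_option \<phi> i = j} = {None}" by auto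
    then show ?thesis using None by (simp add: agg_def)
  next
    case (Some k)
    then have "{i \<in> insert None (Some ` N). map_option \<phi> i = j} = Some ` {i \<in> N. \<phi> i = k}" by auto
    then show ?thesis using Some by (simp add: agg_def sum.reindex)
  qed
qed

text \<open>
  The exchange property of the aggregated function, in terms of vectors of the original domain. The parity
  coordinate is added, left alone by the aggregation, and dropped at the end, where a step in it stands for
  the absence of a second step.
\<close>

theorem jump_Mnat_agg:
  assumes fN: "finite N" and fD: "finite D" and DN: "D \<subseteq> int_vecs N" and jm: "jump_Mnat D f"
    and x: "x \<in> D" "x' \<in> D" and v: "adjacent (agg N \<phi> x) v" "between (agg N \<phi> x) v (agg N \<phi> x')"
  obtains w w' where "w \<in> D" "w' \<in> D" "agg N \<phi> w + agg N \<phi> w' = agg N \<phi> x + agg N \<phi> x'"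
    "f w + f w' \<le> f x + f x'"
    "agg N \<phi> w = v \<or> adjacent v (agg N \<phi> w) \<and> between v (agg N \<phi> w) (agg N \<phi> x')"
proof -
  let ?D = "lift_vec N ` D" and ?f = "\<lambda>z. f (z \<circ> Some)" and ?N = "insert None (Some ` N)"
  let ?A = "agg ?N (map_option \<phi>)" and ?a = "agg N \<phi>"
  have A: "?A (lift_vec N z) = case_option (pcoord N z) (?a z)" for z
    unfolding lift_vec_def using agg_option[OF fN] .
  obtain g where g: "is_push ?A ?D ?f (?A ` ?D) g" using is_push_exists fD by blast
  have DN': "?D \<subseteq> int_vecs ?N" using lift_vec_int_vecs DN by blast
  have "jump_M (?A ` ?D) g"
    using jump_M_agg[OF _ _ DN' jump_M_lift[OF fN fD DN jm] g] fN fD by simp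
  moreover have "?A (lift_vec N x) \<in> ?A ` ?D" "?A (lift_vec N x') \<in> ?A ` ?D" using x by auto
  moreover have "adjacent (?A (lift_vec N x)) (case_option (pcoord N x) v)"
    "between (?A (lift_vec N x)) (case_option (pcoord N x) v) (?A (lift_vec N x'))"
    unfolding A adjacent_option between_option using v by auto
  ultimately obtain z where z: "adjacent (case_option (pcoord N x) v) z"
    "between (case_option (pcoord N x) v) z (?A (lift_vec N x'))"
    "exch (?A ` ?D) g (?A (lift_vec N x)) (?A (lift_vec N x')) z"
    unfolding jump_M_def by blast
  define z' where "z' = ?A (lift_vec N x) + ?A (lift_vec N x') - z"
  have zE: "z \<in> ?A ` ?D" "z' \<in> ?A ` ?D"
    and le: "g z + g z' \<le> g (?A (lift_vec N x)) + g (?A (lift_vec N x'))"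
    using z(3) unfolding exch_def z'_def by auto
  obtain w where w: "w \<in> D" "?A (lift_vec N w) = z" "f w = g z"
    using is_push_attained[OF g zE(1)] by auto
  obtain w' where w': "w' \<in> D" "?A (lift_vec N w') = z'" "f w' = g z'"
    using is_push_attained[OF g zE(2)] by auto
  have gle: "g (?A (lift_vec N x)) \<le> f x" if "x \<in> D" for x
    using g that unfolding is_push_def by fastforce
  have "?a w j + ?a w' j = ?a x j + ?a x' j" for j
  proof -
    have "?A (lift_vec N w) (Some j) + ?A (lift_vec N w') (Some j) =
        ?A (lift_vec N x) (Some j) + ?A (lift_vec N x') (Some j)"
      unfolding w(2) w'(2) z'_def by simp
    then show ?thesis unfolding A by simp
  qed
  then have "?a w + ?a w' = ?a x + ?a x'" by (simp add: fun_eq_iff)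
  moreover have "f w + f w' \<le> f x + f x'"
    using le gle[OF x(1)] gle[OF x(2)] w(3) w'(3) by simp
  moreover have "?a w = v \<or> adjacent v (?a w) \<and> between v (?a w) (?a x')"
    using z(1,2) unfolding w(2)[symmetric] A adjacent_option between_option by blast
  ultimately show ?thesis using that w(1) w'(1) by blast
qed

text \<open>
  The box given by lattice operations is the one described by \<open>between\<close>.
\<close>

lemma in_box_iff: "z \<in> {inf x y..sup x y} \<longleftrightarrow> between x z y" for x y z :: "'a \<Rightarrow> int"
proof -
  have "(inf (x i) (y i) \<le> z i \<and> z i \<le> sup (x i) (y i)) \<longleftrightarrow>
      x i \<le> z i \<and> z i \<le> y i \<or> y i \<le> z i \<and> z i \<le> x i" for i
    by (cases "x i \<le> y i") (auto simp: inf_absorb1 inf_absorb2 sup_absorb1 sup_absorb2)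
  then show ?thesis unfolding between_def atLeastAtMost_iff le_fun_def inf_fun_def sup_fun_def by auto
qed

lemma increment_iff:
  assumes "x \<in> int_vecs N" "y \<in> int_vecs N"
  shows "increment N x y s \<longleftrightarrow> adjacent x (x + s) \<and> between x (x + s) y"
proof
  assume "increment N x y s"
  then obtain i where "s = unit_vec i \<or> s = - unit_vec i" "between x (x + s) y"
    unfolding increment_def in_box_iff by blast
  then show "adjacent x (x + s) \<and> between x (x + s) y"
    unfolding adjacent_def by (auto simp: unit_vec_def intro!: exI[of _ i])
next
  assume s: "adjacent x (x + s) \<and> between x (x + s) y"
  then obtain i where i: "\<bar>(x + s) i - x i\<bar> = 1" "\<And>k. k \<noteq> i \<Longrightarrow> (x + s) k = x k"
    using adjacentE by metis
  have "x + s \<in> int_vecs N" using int_vecs_between s assms by blast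
  then have "i \<in> N" using i(1) assms(1) by (intro ccontr[of "i \<in> N"]) (auto simp: int_vecs_def)
  moreover have "s k = 0" if "k \<noteq> i" for k using i(2)[OF that] by simp
  moreover have "s i = 1 \<or> s i = - 1" using i(1) by auto
  ultimately have "s = unit_vec i \<or> s = - unit_vec i"
    by (auto simp: unit_vec_def fun_eq_iff)
  then show "increment N x y s"
    unfolding increment_def in_box_iff using \<open>i \<in> N\<close> s by blast
qed

lemma between_between:
  assumes "between x p y" "between x q y" "between p w q"
  shows "between x w y"
  unfolding between_def
proof
  fix i
  show "x i \<le> w i \<and> w i \<le> y i \<or> y i \<le> w i \<and> w i \<le> x i"
    using assms(1)[unfolded between_def, rule_format, of i] assms(2)[unfolded between_def, rule_format, of i]
      assms(3)[unfolded between_def, rule_format, of i] by linarith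
qed

lemma finite_between:
  assumes "finite N" "x \<in> int_vecs N" "y \<in> int_vecs N"
  shows "finite {z. between x z y}"
proof (rule finite_subset)
  let ?B = "\<Union>i\<in>N. {min (x i) (y i)..max (x i) (y i)}"
  show "finite {z. \<forall>i. (i \<in> N \<longrightarrow> z i \<in> ?B) \<and> (i \<notin> N \<longrightarrow> z i = 0)}"
    using assms(1) by (intro finite_set_of_finite_funs) auto
  show "{z. between x z y} \<subseteq> {z. \<forall>i. (i \<in> N \<longrightarrow> z i \<in> ?B) \<and> (i \<notin> N \<longrightarrow> z i = 0)}"
  proof (intro subsetI CollectI allI conjI impI)
    fix z i assume z: "z \<in> {z. between x z y}"
    then have zi: "x i \<le> z i \<and> z i \<le> y i \<or> y i \<le> z i \<and> z i \<le> x i"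
      unfolding between_def by blast
    show "z i \<in> ?B" if "i \<in> N" using zi that by (intro UN_I[of i]) auto
    show "z i = 0" if "i \<notin> N" using zi that assms(2,3) by (auto simp: int_vecs_def)
  qed
qed

lemma le_INF_add_INF:
  fixes f g :: "'a \<Rightarrow> ereal"
  assumes "\<And>x y. x \<in> F \<Longrightarrow> y \<in> H \<Longrightarrow> M \<le> f x + g y"
    and "(INF x\<in>F. f x) = ereal a" "(INF y\<in>H. g y) = ereal b"
  shows "M \<le> ereal (a + b)"
proof (rule ccontr)
  assume "\<not> ?thesis"
  then have "ereal (a + b) < M" by simp
  then obtain c where c: "ereal (a + b) < ereal c" "ereal c < M"
    using ereal_dense2 by blast
  define e where "e = (c - a - b) / 2"
  have e: "0 < e" using c(1) by (simp add: e_def)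
  have "(INF x\<in>F. f x) < ereal (a + e)" "(INF y\<in>H. g y) < ereal (b + e)"
    using assms(2,3) e by simp_all
  then obtain x y where xy: "x \<in> F" "f x < ereal (a + e)" "y \<in> H" "g y < ereal (b + e)"
    unfolding INF_less_iff by blast
  have "f x + g y \<le> ereal (a + e) + ereal (b + e)"
    using xy by (intro add_mono) auto
  also have "\<dots> = ereal c" by (simp add: e_def field_simps)
  finally show False using assms(1)[OF xy(1,3)] c(2) by auto
qed

text \<open>
  Restricting a jump M\<open>\<natural>\<close>-convex function to the box spanned by two vectors of its effective domain yields
  a function with finite domain that still has the exchange property, because exchanged vectors stay in the box.
\<close>

lemma jump_Mnat_restrict:
  assumes jm: "jump_M_nat_convex N f" and x: "x \<in> eff_dom N f" "x' \<in> eff_dom N f"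
  shows "jump_Mnat (eff_dom N f \<inter> {z. between x z x'}) (\<lambda>z. real_of_ereal (f z))"
    (is "jump_Mnat ?D ?f")
  unfolding jump_Mnat_def
proof (intro ballI allI impI, elim conjE)
  fix p q u assume p: "p \<in> ?D" and q: "q \<in> ?D" and u: "adjacent p u" "between p u q"
  have fin: "f z = ereal (?f z)" if "z \<in> eff_dom N f" for z
    using that jm unfolding eff_dom_def jump_M_nat_convex_def by (cases "f z") auto
  have ex: "exch ?D ?f p q w"
    if w: "between p w q" "w \<in> eff_dom N f" "p + q - w \<in> eff_dom N f" "f w + f (p + q - w) \<le> f p + f q" for w
  proof -
    have "between x w x'" "between x (p + q - w) x'"
      using between_between p q w(1) between_compl[OF w(1)] by blast+
    moreover have "?f w + ?f (p + q - w) \<le> ?f p + ?f q"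
      using w(4) fin[OF w(2)] fin[OF w(3)] fin p q by (metis IntD1 ereal_less_eq(3) plus_ereal.simps(1))
    ultimately show ?thesis unfolding exch_def using w by blast
  qed
  define s where "s = u - p"
  have us: "u = p + s" by (simp add: s_def)
  have pN: "p \<in> int_vecs N" "q \<in> int_vecs N" using p q unfolding eff_dom_def by auto
  have uN: "u \<in> int_vecs N" using int_vecs_between[OF u(2) pN] .
  have "increment N p q s" unfolding increment_iff[OF pN] using u us by simp
  then consider "p + s \<in> eff_dom N f" "q - s \<in> eff_dom N f" "f (p + s) + f (q - s) \<le> f p + f q"
    | t where "increment N (p + s) q t" "p + s + t \<in> eff_dom N f" "q - s - t \<in> eff_dom N f"
      "f (p + s + t) + f (q - s - t) \<le> f p + f q"
    using jm p q unfolding jump_M_nat_convex_def JM_nat_EXC_def by blast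
  then show "exch ?D ?f p q u \<or> (\<exists>w. adjacent u w \<and> between u w q \<and> exch ?D ?f p q w)"
  proof cases
    case 1
    have "p + q - u = q - s" by (simp add: us)
    then show ?thesis using ex[OF u(2)] 1 us by simp
  next
    case (2 t)
    have w: "adjacent u (u + t)" "between u (u + t) q"
      using 2(1) unfolding us[symmetric] increment_iff[OF uN pN(2)] by auto
    have e: "p + q - (u + t) = q - s - t" by (simp add: us)
    have "exch ?D ?f p q (u + t)"
      using ex[of "u + t"] between_trans(1)[OF u(2) w(2)] 2(2-4) unfolding e unfolding us by simp
    then show ?thesis using w by blast
  qed
qed

text \<open>
  The infimum defining the aggregation need not be attained. For each pair of vectors \<open>x\<close>, \<open>x'\<close> in the fibres of \<open>y\<close> and
  \<open>y'\<close>, restriction to their box yields some second step \<open>t\<close> (0 for none) for which the aggregated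
  value sum after the exchange is at most \<open>f x + f x'\<close>. Only finitely many \<open>t\<close> are possible, hence the least of
  these value sums is at most the sum of the two infima.
\<close>

theorem aggregation_jump_M_nat_convex:
  fixes N :: "'a set" and J :: "'b set"
  assumes fN: "finite N" and fJ: "finite J" and UN: "(\<Union>j\<in>J. B j) = N" and disj: "disjoint_family_on B J"
    and jm: "jump_M_nat_convex N f"
    and bdd: "\<forall>y\<in>int_vecs J. aggregation N J B f y \<noteq> -\<infinity>"
  shows "jump_M_nat_convex J (aggregation N J B f)"
proof -
  let ?g = "aggregation N J B f"
  define \<phi> where "\<phi> i = (THE j. j \<in> J \<and> i \<in> B j)" for i
  have \<phi>: "\<phi> i = j" if "j \<in> J" "i \<in> B j" for i j
    unfolding \<phi>_def using that disj unfolding disjoint_family_on_def by (intro the_equality) blast+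
  have fib: "{i \<in> N. \<phi> i = j} = B j" if "j \<in> J" for j
    using \<phi> that UN by blast
  have fib0: "{i \<in> N. \<phi> i = j} = {}" if "j \<notin> J" for j
    using \<phi> that UN by blast
  let ?A = "agg N \<phi>"
  have AJ: "?A x \<in> int_vecs J" for x
    unfolding int_vecs_def agg_def using fib0 by (auto intro: sum.neutral)
  define F where "F y = {x \<in> int_vecs N. ?A x = y}" for y
  have g: "?g y = (INF x\<in>F y. f x)" if "y \<in> int_vecs J" for y
  proof -
    have "(\<forall>j\<in>J. (\<Sum>i\<in>B j. x i) = y j) \<longleftrightarrow> ?A x = y" for x
    proof -
      have "?A x j = (\<Sum>i\<in>B j. x i)" if "j \<in> J" for j unfolding agg_def fib[OF that] ..
      moreover have "?A x j = y j" if "j \<notin> J" for j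
        using that AJ[of x] \<open>y \<in> int_vecs J\<close> by (auto simp: int_vecs_def)
      ultimately show ?thesis by (metis ext)
    qed
    then show ?thesis unfolding aggregation_def F_def by simp
  qed
  have gle: "?g (?A x) \<le> f x" if "x \<in> int_vecs N" for x
    unfolding g[OF AJ] using that by (intro INF_lower) (auto simp: F_def)
  have fbot: "f x \<noteq> -\<infinity>" if "x \<in> int_vecs N" for x
    using jm that unfolding jump_M_nat_convex_def by blast
  have dom: "eff_dom J ?g \<noteq> {}"
  proof -
    obtain x where "x \<in> eff_dom N f" using jm unfolding jump_M_nat_convex_def by blast
    then have "?A x \<in> eff_dom J ?g"
      using gle[of x] AJ unfolding eff_dom_def by auto
    then show ?thesis by blast
  qed
  have "JM_nat_EXC J ?g"
    unfolding JM_nat_EXC_def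
  proof (intro ballI allI impI)
    fix y y' s assume y: "y \<in> eff_dom J ?g" "y' \<in> eff_dom J ?g" and s: "increment J y y' s"
    have yJ: "y \<in> int_vecs J" "y' \<in> int_vecs J" using y unfolding eff_dom_def by auto
    define v where "v = y + s"
    have v: "adjacent y v" "between y v y'" using s unfolding increment_iff[OF yJ] v_def by auto
    have vJ: "v \<in> int_vecs J" using int_vecs_between[OF v(2) yJ] .
    \<comment> \<open>The admissible second steps, with 0 for none.\<close>
    define T where "T = {t. t = 0 \<or> increment J v y' t}"
    have tJ: "v + t \<in> int_vecs J" "y' - s - t \<in> int_vecs J" if "t \<in> T" for t
    proof -
      show "v + t \<in> int_vecs J"
        using that vJ int_vecs_between[OF _ vJ yJ(2)] unfolding T_def increment_iff[OF vJ yJ(2)] by auto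
      then have "y + y' - (v + t) \<in> int_vecs J" using yJ by (simp add: int_vecs_def)
      then show "y' - s - t \<in> int_vecs J" by (simp add: v_def int_vecs_def algebra_simps)
    qed
    have "T \<subseteq> insert 0 (unit_vec ` J \<union> (\<lambda>j. - unit_vec j) ` J)"
      unfolding T_def increment_def by auto
    then have fT: "finite T" using fJ finite_subset by blast
    let ?S = "\<lambda>t. ?g (v + t) + ?g (y' - s - t)"
    obtain a b where ab: "?g y = ereal a" "?g y' = ereal b"
    proof -
      have "?g y \<noteq> -\<infinity>" "?g y' \<noteq> -\<infinity>" "?g y < \<infinity>" "?g y' < \<infinity>"
        using y bdd unfolding eff_dom_def by auto
      then show ?thesis using that by (cases "?g y"; cases "?g y'") auto
    qed
    have "Min (?S ` T) \<le> ereal (a + b)"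
    proof (rule le_INF_add_INF)
      show "(INF x\<in>F y. f x) = ereal a" "(INF x\<in>F y'. f x) = ereal b"
        using ab g yJ by auto
      fix x x' assume x: "x \<in> F y" "x' \<in> F y'"
      have xN: "x \<in> int_vecs N" "x' \<in> int_vecs N" "?A x = y" "?A x' = y'" using x unfolding F_def by auto
      show "Min (?S ` T) \<le> f x + f x'"
      proof (cases "f x < \<infinity> \<and> f x' < \<infinity>")
        case False
        then show ?thesis using fbot xN by auto
      next
        case True
        then have xd: "x \<in> eff_dom N f" "x' \<in> eff_dom N f" using xN unfolding eff_dom_def by auto
        let ?D = "eff_dom N f \<inter> {z. between x z x'}"
        have D: "finite ?D" "?D \<subseteq> int_vecs N" "x \<in> ?D" "x' \<in> ?D"
          using finite_between[OF fN xN(1,2)] xd unfolding eff_dom_def by auto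
        obtain w w' where w: "w \<in> ?D" "w' \<in> ?D" "?A w + ?A w' = ?A x + ?A x'"
          "real_of_ereal (f w) + real_of_ereal (f w') \<le> real_of_ereal (f x) + real_of_ereal (f x')"
          "?A w = v \<or> adjacent v (?A w) \<and> between v (?A w) (?A x')"
          using jump_Mnat_agg[OF fN D(1,2) jump_Mnat_restrict[OF jm xd] D(3,4), of \<phi> v] v xN(3,4) by auto
        define t where "t = ?A w - v"
        have vt: "?A w = v + t" by (simp add: t_def)
        have "t \<in> T"
          using w(5) unfolding T_def increment_iff[OF vJ yJ(2)] vt xN(4) by auto
        have "?A w' = ?A x + ?A x' - ?A w" using w(3) by (simp add: algebra_simps)
        then have w't: "?A w' = y' - s - t" unfolding vt xN(3,4) v_def by simp
        have fin: "f z = ereal (real_of_ereal (f z))" if "z \<in> eff_dom N f" for z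
          using that fbot unfolding eff_dom_def by (cases "f z") auto
        have "Min (?S ` T) \<le> ?S t" using fT \<open>t \<in> T\<close> by (intro Min_le) auto
        also have "\<dots> \<le> f w + f w'"
          using gle[of w] gle[of w'] w(1,2) D(2) vt w't by (intro add_mono) auto
        also have "\<dots> \<le> f x + f x'"
          using w(4) fin[of w] fin[of w'] fin[of x] fin[of x'] w(1,2) xd
          by (metis IntD1 ereal_less_eq(3) plus_ereal.simps(1))
        finally show ?thesis .
      qed
    qed
    moreover have "T \<noteq> {}" unfolding T_def by auto
    then have "Min (?S ` T) \<in> ?S ` T" using fT by (intro Min_in) auto
    ultimately obtain t where t: "t \<in> T" "?S t \<le> ?g y + ?g y'" using ab by auto
    have "?g (v + t) \<noteq> -\<infinity>" "?g (y' - s - t) \<noteq> -\<infinity>" using bdd tJ[OF t(1)] by auto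
    then have "?g (v + t) < \<infinity>" "?g (y' - s - t) < \<infinity>"
      using t(2) ab by (cases "?g (v + t)"; cases "?g (y' - s - t)"; simp)+
    then have d: "v + t \<in> eff_dom J ?g" "y' - s - t \<in> eff_dom J ?g"
      using tJ[OF t(1)] unfolding eff_dom_def by auto
    show "y + s \<in> eff_dom J ?g \<and> y' - s \<in> eff_dom J ?g \<and> ?g (y + s) + ?g (y' - s) \<le> ?g y + ?g y' \<or>
      (\<exists>t. increment J (y + s) y' t \<and> y + s + t \<in> eff_dom J ?g \<and> y' - s - t \<in> eff_dom J ?g \<and>
        ?g (y + s + t) + ?g (y' - s - t) \<le> ?g y + ?g y')"
    proof (cases "t = 0")
      case True
      then show ?thesis using d t(2) unfolding v_def by simp
    next
      case False
      then have "increment J (y + s) y' t" using t(1) unfolding T_def v_def by blast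
      then show ?thesis using d t(2) unfolding v_def by blast
    qed
  qed
  then show ?thesis using bdd dom unfolding jump_M_nat_convex_def by blast
qed

theorem theorem4p6:
  fixes n m :: nat
    and B :: "nat \<Rightarrow> nat set"
    and f :: "(nat \<Rightarrow> int) \<Rightarrow> ereal"
  assumes "(\<Union>j\<in>{1..m}. B j) = {1..n}"
    and "disjoint_family_on B {1..m}"
    and "\<forall>j\<in>{1..m}. B j \<noteq> {}"
    and "jump_M_nat_convex {1..n} f"
    and "\<forall>y\<in>int_vecs {1..m}. aggregation {1..n} {1..m} B f y \<noteq> -\<infinity>"
  shows "jump_M_nat_convex {1..m} (aggregation {1..n} {1..m} B f)"
  using aggregation_jump_M_nat_convex[OF _ _ assms(1,2,4,5)] by simp

end
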